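(* Let $f:\mathbb{R}^n\to\mathbb{R}^n$ be a convex monotone subhomogeneous map that has a fixed point. Then all the conclusions of the Convex Spectral Theorem apply to $f$ and $\lambda=0$. That is, let $\mathscr{E}(f)=\{x\in\mathbb{R}^n\mid f(x)=x\}$, let $C=N^{c}(f)$ be the set of critical nodes of $f$ and $c=\mathsf{c}(f)$ its cyclicity; then: (1) the restriction $\mathsf{r}:\mathbb{R}^n\to\mathbb{R}^C$, $x\mapsto(x_i)_{i\in C}$, is a monotone homogeneous isomorphism from $\mathscr{E}(f)$ to its image $\mathscr{E}^{c}(f)=\mathsf{r}(\mathscr{E}(f))$; (2) $\mathscr{E}^{c}(f)$ is an inf-subsemilattice of $(\mathbb{R}^C,\le)$; (3) $\mathscr{E}^{c}(f)$ is a convex set whose dimension is at most equal to the number of critical classes of $f$, and this bound is attained when $f$ is piecewise affine; (4) for all $x\in\mathbb{R}^n$, $f^{kc}(x)$ has a limit when $k\to\infty$. In particular, if $f$ has no critical classes, then its fixed point is unique.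
   Context: $\leq$ is the entrywise order and $\lambda+x=(\lambda+x_1,\dots,\lambda+x_n)$. A map $f$ is monotone if $x\le y\Rightarrow f(x)\le f(y)$, (additively) homogeneous if $f(\lambda+x)=\lambda+f(x)$ for all $\lambda\in\mathbb{R}$ and all $x$, and (additively) subhomogeneous if $f(\lambda+x)\le\lambda+f(x)$ for all $\lambda\ge0$ and all $x$; it is convex if each coordinate is convex. A monotone homogeneous map $g:U\subset\mathbb{R}^n\to V\subset\mathbb{R}^p$ is a monotone homogeneous isomorphism if it has a monotone homogeneous inverse. An inf-subsemilattice of $\mathbb{R}^C$ is a subset stable under entrywise minimum. The dimension of a convex set is the dimension of its affine hull. $f$ is piecewise affine if $\mathbb{R}^n$ can be covered by finitely many polyhedra on each of which $f$ is affine. For a convex monotone subhomogeneous map $f$ with a fixed point $v$, let $\partial f(v)=\{P\in\mathbb{R}^{n\times n}\mid f(x)-f(v)\ge P(x-v)\ \forall x\in\mathbb{R}^n\}$; its elements are nonnegative matrices with row sums at most $1$. For a nonnegative matrix $P$, $\mathscr{G}(P)$ is the directed graph on $\{1,\dots,n\}$ with arcs $i\to j$ when $P_{ij}\ne0$; its classes are the equivalence classes for mutual accessibility (each node has access to itself) and a class is final if no node in it has access to a node outside it. The critical graph $\mathscr{G}^{c}(f)$ is the union of the graphs of the matrices $P_{FF}$, where $P\in\partial f(v)$, $F$ is a final class of $P$, and the $F\times F$ submatrix $P_{FF}$ is stochastic; it may be empty and does not depend on the choice of the fixed point $v$. $N^{c}(f)$ is its set of nodes; the critical classes of $f$ are the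 node sets of the strongly connected components $\mathscr{G}_1,\dots,\mathscr{G}_s$ of $\mathscr{G}^{c}(f)$; $\mathsf{c}(\mathscr{G}_i)$ is the gcd of the lengths of the circuits of $\mathscr{G}_i$, and $\mathsf{c}(f)=\mathrm{lcm}(\mathsf{c}(\mathscr{G}_1),\dots,\mathsf{c}(\mathscr{G}_s))$. When $\mathscr{G}^{c}(f)$ is empty, $N^{c}(f)=\varnothing$, $\mathbb{R}^\varnothing=\{0\}$ and $\mathsf{c}(f)=1$.
   Formalization: In (1), homogeneity g(λ+x)=λ+g(x) of a map g:U→V is required only when λ+x is in U and λ+g(x) is in V; without the latter the inverse of r need not be homogeneous, e.g. for f(x1,x2)=(x1,x1/2). *)

theory Defs
  imports "HOL-Analysis.Analysis"
begin

text \<open>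
  \<open>\<real>\<^sup>C\<close>, for a set \<open>C\<close> of coordinates, is realised as the subspace of the vectors of
  \<open>real ^ 'n\<close> that vanish outside \<open>C\<close>; the order, \<open>inf\<close>, convexity and \<open>aff_dim\<close> of \<open>real ^ 'n\<close>
  restrict to those of \<open>\<real>\<^sup>C\<close>, and \<open>\<real>\<^sup>C = {0}\<close> when \<open>C = {}\<close>.
\<close>

definition coord_space :: "'n::finite set \<Rightarrow> (real ^ 'n) set" where
  "coord_space C = {x. \<forall>i. i \<notin> C \<longrightarrow> x $ i = 0}"

definition restr :: "'n::finite set \<Rightarrow> real ^ 'n \<Rightarrow> real ^ 'n" where
  "restr C x = (\<chi> i. if i \<in> C then x $ i else 0)"

text \<open>The operation \<open>\<lambda> + x\<close> on \<open>\<real>\<^sup>C\<close>: only the coordinates in \<open>C\<close> are shifted.\<close>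

definition shift :: "'n::finite set \<Rightarrow> real \<Rightarrow> real ^ 'n \<Rightarrow> real ^ 'n" where
  "shift C l x = restr C (vec l) + x"

definition subhomogeneous :: "(real ^ 'n::finite \<Rightarrow> real ^ 'n) \<Rightarrow> bool" where
  "subhomogeneous f \<longleftrightarrow> (\<forall>l\<ge>0. \<forall>x. f (vec l + x) \<le> vec l + f x)"

definition convex_map :: "(real ^ 'n::finite \<Rightarrow> real ^ 'm::finite) \<Rightarrow> bool" where
  "convex_map f \<longleftrightarrow> (\<forall>i. convex_on UNIV (\<lambda>x. f x $ i))"

definition piecewise_affine :: "(real ^ 'n::finite \<Rightarrow> real ^ 'm::finite) \<Rightarrow> bool" where
  "piecewise_affine f \<longleftrightarrow> (\<exists>S. finite S \<and> \<Union>S = UNIV \<and>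
     (\<forall>K\<in>S. polyhedron K \<and> (\<exists>A b. \<forall>x\<in>K. f x = A *v x + b)))"

text \<open>
  Monotone homogeneous maps from \<open>U \<subseteq> \<real>\<^sup>I\<close> to \<open>V \<subseteq> \<real>\<^sup>J\<close>.  The sets \<open>U\<close> and \<open>V\<close> need not be stable
  under \<open>x \<mapsto> \<lambda> + x\<close>, so the equation \<open>g (\<lambda> + x) = \<lambda> + g x\<close> in \<open>V\<close> is required whenever both sides
  make sense, i.e. when \<open>\<lambda> + x \<in> U\<close> and \<open>\<lambda> + g x \<in> V\<close>.  If \<open>V\<close> is stable, in particular if
  \<open>V = \<real>\<^sup>J\<close>, the second condition is void.  It cannot be dropped in general: the fixed points of
  \<open>f (x\<^sub>1, x\<^sub>2) = (x\<^sub>1, x\<^sub>1 / 2)\<close> are the points \<open>(t, t / 2)\<close>, the critical set is \<open>{1}\<close>,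
  and \<open>t \<mapsto> (t, t / 2)\<close> does not commute with all shifts of \<open>t\<close>.
\<close>

definition mono_homog_map ::
  "'n::finite set \<Rightarrow> 'm::finite set \<Rightarrow> (real ^ 'n) set \<Rightarrow> (real ^ 'm) set
     \<Rightarrow> (real ^ 'n \<Rightarrow> real ^ 'm) \<Rightarrow> bool" where
  "mono_homog_map I J U V g \<longleftrightarrow>
     U \<subseteq> coord_space I \<and> V \<subseteq> coord_space J \<and> g ` U \<subseteq> V \<and> mono_on U g \<and>
     (\<forall>l. \<forall>x\<in>U. shift I l x \<in> U \<longrightarrow> shift J l (g x) \<in> V \<longrightarrow> g (shift I l x) = shift J l (g x))"

definition mono_homog_iso ::
  "'n::finite set \<Rightarrow> 'm::finite set \<Rightarrow> (real ^ 'n) set \<Rightarrow> (real ^ 'm) set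
     \<Rightarrow> (real ^ 'n \<Rightarrow> real ^ 'm) \<Rightarrow> bool" where
  "mono_homog_iso I J U V g \<longleftrightarrow> mono_homog_map I J U V g \<and>
     (\<exists>h. mono_homog_map J I V U h \<and> (\<forall>x\<in>U. h (g x) = x) \<and> (\<forall>y\<in>V. g (h y) = y))"

definition inf_subsemilattice :: "(real ^ 'n::finite) set \<Rightarrow> bool" where
  "inf_subsemilattice U \<longleftrightarrow> (\<forall>x\<in>U. \<forall>y\<in>U. inf x y \<in> U)"

text \<open>
  Directed graphs are given by a node set \<open>V\<close> and an arc relation \<open>A\<close>; \<open>A\<^sup>*\<close> is accessibility.
  \<open>classes V A\<close> consists of the node sets of the strongly connected components.
\<close>

definition classes :: "'a set \<Rightarrow> 'a rel \<Rightarrow> 'a set set" where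
  "classes V A = V // {(i, j). i \<in> V \<and> j \<in> V \<and> (i, j) \<in> A\<^sup>* \<and> (j, i) \<in> A\<^sup>*}"

definition matrix_arcs :: "real ^ 'n ^ 'n::finite \<Rightarrow> 'n rel" where
  "matrix_arcs P = {(i, j). P $ i $ j \<noteq> 0}"

definition final_class :: "real ^ 'n ^ 'n::finite \<Rightarrow> 'n set \<Rightarrow> bool" where
  "final_class P F \<longleftrightarrow> F \<in> classes UNIV (matrix_arcs P) \<and>
     (\<forall>i\<in>F. \<forall>j. (i, j) \<in> (matrix_arcs P)\<^sup>* \<longrightarrow> j \<in> F)"

definition stochastic_on :: "'n::finite set \<Rightarrow> real ^ 'n ^ 'n \<Rightarrow> bool" where
  "stochastic_on F P \<longleftrightarrow> (\<forall>i\<in>F. (\<forall>j\<in>F. 0 \<le> P $ i $ j) \<and> (\<Sum>j\<in>F. P $ i $ j) = 1)"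

definition subdiff :: "(real ^ 'n::finite \<Rightarrow> real ^ 'n) \<Rightarrow> real ^ 'n \<Rightarrow> (real ^ 'n ^ 'n) set" where
  "subdiff f v = {P. \<forall>x. P *v (x - v) \<le> f x - f v}"

text \<open>
  The critical graph is defined from a fixed point \<open>v\<close> of \<open>f\<close>.  It does not depend on the choice
  of \<open>v\<close>, but \<open>v\<close> is kept as a parameter so that the definitions need no choice operator.
\<close>

definition crit_nodes :: "(real ^ 'n::finite \<Rightarrow> real ^ 'n) \<Rightarrow> real ^ 'n \<Rightarrow> 'n set" where
  "crit_nodes f v = \<Union>{F. \<exists>P\<in>subdiff f v. final_class P F \<and> stochastic_on F P}"

definition crit_arcs :: "(real ^ 'n::finite \<Rightarrow> real ^ 'n) \<Rightarrow> real ^ 'n \<Rightarrow> 'n rel" where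
  "crit_arcs f v =
     \<Union>{matrix_arcs P \<inter> F \<times> F | P F. P \<in> subdiff f v \<and> final_class P F \<and> stochastic_on F P}"

definition crit_classes :: "(real ^ 'n::finite \<Rightarrow> real ^ 'n) \<Rightarrow> real ^ 'n \<Rightarrow> 'n set set" where
  "crit_classes f v = classes (crit_nodes f v) (crit_arcs f v)"

text \<open>Circuits are closed paths of positive length, not necessarily elementary.\<close>

definition class_cyclicity :: "'a rel \<Rightarrow> 'a set \<Rightarrow> nat" where
  "class_cyclicity A K = Gcd {k. k > 0 \<and> (\<exists>i\<in>K. (i, i) \<in> (A \<inter> K \<times> K) ^^ k)}"

definition cyclicity :: "(real ^ 'n::finite \<Rightarrow> real ^ 'n) \<Rightarrow> real ^ 'n \<Rightarrow> nat" where
  "cyclicity f v = Lcm (class_cyclicity (crit_arcs f v) ` crit_classes f v)"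

definition fixed_points :: "(real ^ 'n::finite \<Rightarrow> real ^ 'n) \<Rightarrow> (real ^ 'n) set" where
  "fixed_points f = {x. f x = x}"

definition crit_fixed_points ::
  "(real ^ 'n::finite \<Rightarrow> real ^ 'n) \<Rightarrow> real ^ 'n \<Rightarrow> (real ^ 'n) set" where
  "crit_fixed_points f v = restr (crit_nodes f v) ` fixed_points f"

end

theory Submission
  imports Defs
begin

text \<open>
  If \<open>P \<in> \<partial>f(v)\<close> has a stationary measure, its support is a union of critical final classes.  Two
  fixed points that are comparable on the critical nodes but not everywhere would produce, by
  transporting mass with subgradients from the nodes where their difference is minimal, a stationary
  measure off the critical nodes; hence fixed points are determined by their critical coordinates.
  The same argument works for pairs of complete backward orbits in a compact set.

  A point \<open>w\<close> with \<open>f w \<le> w\<close> differs from \<open>v\<close> by a constant on each critical class, and its orbit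
  decreases to a fixed point with the same critical coordinates.  This gives the semilattice and
  convexity statements and the dimension bound.  If \<open>f\<close> is piecewise affine, Farkas' lemma yields
  such a \<open>w\<close> at which only the critical rows are tight, and \<open>w\<close> may be perturbed independently on
  each critical class.

  On the limit set of an orbit, \<open>f\<close> acts on the critical nodes through every critical matrix, which
  forces \<open>f\<^sup>c(y) = y\<close> on these nodes, hence everywhere; nonexpansiveness then gives convergence.
\<close>

section \<open>Convexity, gcds and graphs\<close>

text \<open>The main obstacle is that the critical graph is built from subgradients at the single
  point \<open>v\<close>, whereas comparing two orbits only produces subgradients along an orbit,
  which need not depend continuously on the base point. Convexity bridges the gap: a subgradient
  \<open>P\<close> at \<open>a\<close> is a subgradient at \<open>v\<close> up to the nonnegative
  error \<open>f v - f a - P *v (v - a)\<close>, and averaging over a long time makes this error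
  negligible. Supersolutions (\<open>f w \<le> w\<close>) appear because minima and convex
  combinations of fixed points have this property but are in general not fixed points.
  Subhomogeneity makes \<open>f\<close> nonexpansive in the sup norm, so that orbits are bounded
  once a fixed point exists; it also bounds the row sums of subgradients by 1.\<close>

lemma subgradient_exists:
  fixes g :: "'a::euclidean_space \<Rightarrow> real"
  assumes "convex_on UNIV g"
  obtains p where "\<And>z. g x + p \<bullet> (z - x) \<le> g z"
proof -
  \<comment> \<open>The strict epigraph misses the graph point \<open>(x, g x)\<close>, so weak
    separation is enough, provided that the normal \<open>(q, s)\<close> has
    \<open>s > 0\<close>.\<close>
  let ?T = "{(z, t). g z < t}"
  have "convex ?T"
  proof (rule convexI, clarsimp)
    fix z1 t1 z2 t2 and u w :: real
    assume *: "g z1 < t1" "g z2 < t2" "0 \<le> u" "0 \<le> w" "u + w = 1"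
    have "g (u *\<^sub>R z1 + w *\<^sub>R z2) \<le> u * g z1 + w * g z2"
      using assms * unfolding convex_on_def by auto
    also have "\<dots> < u * t1 + w * t2"
    proof (cases "u = 0")
      case True then show ?thesis using * by auto
    next
      case False
      then have "u * g z1 < u * t1" "w * g z2 \<le> w * t2"
        using * by (auto intro: mult_left_mono)
      then show ?thesis by linarith
    qed
    finally show "g (u *\<^sub>R z1 + w *\<^sub>R z2) < u * t1 + w * t2" .
  qed
  moreover have "(x, g x + 1) \<in> ?T" by simp
  moreover have "{(x, g x)} \<inter> ?T = {}" by auto
  ultimately obtain a b where ab: "a \<noteq> 0" "\<forall>y\<in>{(x, g x)}. a \<bullet> y \<le> b" "\<forall>y\<in>?T. a \<bullet> y \<ge> b"
    using separating_hyperplane_sets[of "{(x, g x)}" ?T] by (metis convex_singleton empty_iff insert_not_empty)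
  obtain q s where a: "a = (q, s)" by (cases a)
  have le: "q \<bullet> x + s * g x \<le> q \<bullet> z + s * t" if "g z < t" for z t
  proof -
    have "(z, t) \<in> ?T" using that by simp
    then have "a \<bullet> (x, g x) \<le> a \<bullet> (z, t)" using ab(2,3) by (metis order_trans insertI1)
    then show ?thesis by (simp add: a)
  qed
  have "s \<ge> 0" using le[of x "g x + 1"] by (simp add: algebra_simps)
  \<comment> \<open>The hyperplane cannot be vertical because \<open>g\<close> is finite everywhere:
    test it at \<open>x - q\<close>.\<close>
  moreover have "s \<noteq> 0"
  proof
    assume s: "s = 0"
    have "q \<bullet> x \<le> q \<bullet> (x - q)" using le[of "x - q" "g (x - q) + 1"] s by simp
    then have "q \<bullet> q \<le> 0" by (simp add: inner_diff_right)
    then have "q = 0" by (metis inner_ge_zero inner_eq_zero_iff order_antisym)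
    then show False using ab(1) a s by (simp add: zero_prod_def)
  qed
  ultimately have s: "s > 0" by simp
  have "g x + (- (1 / s) *\<^sub>R q) \<bullet> (z - x) \<le> g z" for z
  proof (rule dense_ge)
    fix t assume "g z < t"
    then have "s * g x + (q \<bullet> x - q \<bullet> z) \<le> s * t" using le[of z t] by simp
    then have "(s * g x + (q \<bullet> x - q \<bullet> z)) / s \<le> t" using s by (simp add: pos_divide_le_eq mult.commute)
    then show "g x + (- (1 / s) *\<^sub>R q) \<bullet> (z - x) \<le> t"
      using s by (simp add: inner_diff_right add_divide_distrib diff_divide_distrib)
  qed
  then show ?thesis using that by blast
qed

text \<open>The least positive difference of two elements divides every element, hence is the gcd.\<close>

lemma Gcd_add_closed_difference:
  fixes S :: "nat set"
  assumes add: "\<And>a b. a \<in> S \<Longrightarrow> b \<in> S \<Longrightarrow> a + b \<in> S"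
    and pos: "\<And>a. a \<in> S \<Longrightarrow> a > 0" and ne: "S \<noteq> {}"
  obtains a where "a \<in> S" "a + Gcd S \<in> S"
proof -
  define D where "D = {d. d > 0 \<and> (\<exists>a. a \<in> S \<and> a + d \<in> S)}"
  have mult: "q * a \<in> S" if "a \<in> S" "q > 0" for a q
    using that(2)
  proof (induction q)
    case (Suc q)
    then show ?case using that(1) add by (cases "q = 0") auto
  qed simp
  have sub: "s \<in> D" if "s \<in> S" for s
    using that add[of s s] pos[of s] by (auto simp: D_def)
  define d where "d = (LEAST d. d \<in> D)"
  have "d \<in> D" using ne sub unfolding d_def by (metis LeastI ex_in_conv)
  then obtain a where a: "d > 0" "a \<in> S" "a + d \<in> S" by (auto simp: D_def)
  have least: "d \<le> e" if "e \<in> D" for e using that by (simp add: d_def Least_le)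
  have dvd: "d dvd s" if s: "s \<in> S" for s
  proof (rule ccontr)
    assume nd: "\<not> d dvd s"
    let ?q = "s div d" and ?r = "s mod d"
    have r: "?r > 0" "?r < d" using nd a(1) by (auto simp: dvd_eq_mod_eq_0)
    have "d \<le> s" using least sub s by blast
    then have q: "?q > 0" using a(1) by (simp add: div_greater_zero_iff)
    \<comment> \<open>If \<open>d\<close> does not divide \<open>s\<close>, the remainder is a
      positive difference of two elements of \<open>S\<close> that is smaller than
      \<open>d\<close>.\<close>
    have "?q * (a + d) + ?r = s + ?q * a"
      using div_mult_mod_eq[of s d] by (simp only: distrib_left add.assoc)
    moreover have "?q * (a + d) \<in> S" "s + ?q * a \<in> S"
      using mult[OF a(3) q] add[OF s mult[OF a(2) q]] by auto
    ultimately have "?r \<in> D" using r unfolding D_def by (metis (mono_tags, lifting) mem_Collect_eq)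
    then show False using least r by fastforce
  qed
  have "Gcd S = d"
  proof (rule dvd_antisym)
    have "Gcd S dvd (a + d) - a" using a by (intro dvd_diff_nat) auto
    then show "Gcd S dvd d" by simp
    show "d dvd Gcd S" using dvd by (intro Gcd_greatest) auto
  qed
  then show ?thesis using a that by blast
qed

section \<open>Finitely generated cones and Farkas' lemma\<close>

lemma convex_cone_hull_finite_image:
  fixes g :: "'i \<Rightarrow> 'a::real_vector"
  assumes "finite I" "x \<in> convex_cone hull (g ` I)"
  obtains c where "\<And>k. 0 \<le> (c k :: real)" "x = (\<Sum>k\<in>I. c k *\<^sub>R g k)"
proof -
  let ?H = "{x. \<exists>c::'i \<Rightarrow> real. (\<forall>k. 0 \<le> c k) \<and> x = (\<Sum>k\<in>I. c k *\<^sub>R g k)}"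
  have "convex_cone ?H"
    unfolding convex_cone_iff
  proof (intro conjI ballI allI impI)
    show "0 \<in> ?H" by (auto intro!: exI[of _ "\<lambda>_. 0"])
    fix y z assume "y \<in> ?H" "z \<in> ?H"
    then obtain c e where "\<forall>k. 0 \<le> c k" "\<forall>k. 0 \<le> e k"
        "y = (\<Sum>k\<in>I. c k *\<^sub>R g k)" "z = (\<Sum>k\<in>I. e k *\<^sub>R g k)" by blast
    then show "y + z \<in> ?H"
      by (auto intro!: exI[of _ "\<lambda>k. c k + e k"] simp: scaleR_add_left sum.distrib)
  next
    fix y and r :: real assume "y \<in> ?H" "0 \<le> r"
    then obtain c where "\<forall>k. 0 \<le> c k" "y = (\<Sum>k\<in>I. c k *\<^sub>R g k)" by blast
    then show "r *\<^sub>R y \<in> ?H" using \<open>0 \<le> r\<close>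
      by (auto intro!: exI[of _ "\<lambda>k. r * c k"] simp: scaleR_sum_right)
  qed
  moreover have "g ` I \<subseteq> ?H"
  proof clarify
    fix k assume "k \<in> I"
    then show "\<exists>c::'i \<Rightarrow> real. (\<forall>k. 0 \<le> c k) \<and> g k = (\<Sum>k\<in>I. c k *\<^sub>R g k)"
      using assms(1) by (intro exI[of _ "\<lambda>l. if l = k then 1 else 0"]) (simp add: if_distrib[of "\<lambda>c. c *\<^sub>R _"] cong: if_cong)
  qed
  ultimately have "convex_cone hull (g ` I) \<subseteq> ?H" by (rule hull_minimal[rotated])
  then show ?thesis using assms(2) that by blast
qed

text \<open>If \<open>- g k0\<close> lies in the cone generated by the \<open>g k\<close>, adding
  one more copy of \<open>g k0\<close> yields the vanishing combination. Otherwise a hyperplane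
  strictly separates it from this closed cone, and the normal is \<open>u\<close>.\<close>

lemma Farkas_strict:
  fixes g :: "'i \<Rightarrow> 'a::euclidean_space"
  assumes "finite I" "k0 \<in> I"
  shows "(\<exists>u. (\<forall>k\<in>I. 0 \<le> g k \<bullet> u) \<and> 0 < g k0 \<bullet> u) \<or>
         (\<exists>c::'i \<Rightarrow> real. (\<forall>k. 0 \<le> c k) \<and> 0 < c k0 \<and> (\<Sum>k\<in>I. c k *\<^sub>R g k) = 0)"
proof (cases "- g k0 \<in> convex_cone hull (g ` I)")
  case True
  then obtain c where c: "\<And>k. 0 \<le> (c k :: real)" "- g k0 = (\<Sum>k\<in>I. c k *\<^sub>R g k)"
    using assms(1) convex_cone_hull_finite_image by metis
  let ?c = "\<lambda>k. c k + (if k = k0 then 1 else 0)"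
  have "(\<Sum>k\<in>I. ?c k *\<^sub>R g k) = (\<Sum>k\<in>I. c k *\<^sub>R g k) + (\<Sum>k\<in>I. if k = k0 then g k else 0)"
    by (subst sum.distrib[symmetric]) (intro sum.cong, auto simp: scaleR_add_left)
  also have "\<dots> = 0" using assms c(2)[symmetric] by simp
  finally show ?thesis using c(1) by (intro disjI2 exI[of _ ?c]) (auto simp: add_nonneg_pos)
next
  case False
  have "closed (convex_cone hull (g ` I))" using assms(1) by (simp add: closed_convex_cone_hull)
  then obtain a b where ab: "a \<bullet> (- g k0) < b" "\<forall>x\<in>convex_cone hull (g ` I). a \<bullet> x > b"
    using separating_hyperplane_closed_point[OF convex_convex_cone_hull _ False] by blast
  have b: "b < 0" using ab(2) convex_cone_hull_contains_0[of "g ` I"] by force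
  have "0 \<le> a \<bullet> g k" if "k \<in> I" for k
  proof (rule ccontr)
    assume n: "\<not> 0 \<le> a \<bullet> g k"
    \<comment> \<open>This multiple is chosen so that its inner product with \<open>a\<close> is
      exactly \<open>b\<close>; its factor is positive since both signs are negative.\<close>
    have "(b / (a \<bullet> g k)) *\<^sub>R g k \<in> convex_cone hull (g ` I)"
      using that n b by (intro convex_cone_hull_mul hull_inc) (auto simp: divide_nonpos_neg)
    then have "a \<bullet> ((b / (a \<bullet> g k)) *\<^sub>R g k) > b" using ab(2) by blast
    then show False using n by simp
  qed
  moreover have "0 < a \<bullet> g k0" using ab b by simp
  ultimately show ?thesis by (metis inner_commute)
qed

section \<open>Final classes and stationary measures\<close>

lemma final_class_reachable:
  assumes "final_class P F" "i \<in> F"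
  shows "F = {j. (i, j) \<in> (matrix_arcs P)\<^sup>*}"
proof -
  let ?A = "matrix_arcs P"
  obtain k where "F = {j. (k, j) \<in> ?A\<^sup>* \<and> (j, k) \<in> ?A\<^sup>*}"
    using assms(1) unfolding final_class_def classes_def quotient_def by auto
  then have "(l, j) \<in> ?A\<^sup>*" if "l \<in> F" "j \<in> F" for l j
    using that by (auto intro: rtrancl_trans)
  then have "F \<subseteq> {j. (i, j) \<in> ?A\<^sup>*}" using assms(2) by blast
  moreover have "{j. (i, j) \<in> ?A\<^sup>*} \<subseteq> F" using assms unfolding final_class_def by blast
  ultimately show ?thesis by blast
qed

lemma final_class_connected:
  assumes "final_class P F" "i \<in> F" "j \<in> F"
  shows "(i, j) \<in> (matrix_arcs P \<inter> F \<times> F)\<^sup>*"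
proof -
  have "(i, j) \<in> (matrix_arcs P)\<^sup>*" using final_class_reachable[OF assms(1,2)] assms(3) by auto
  then show ?thesis
  proof (induction rule: rtrancl_induct)
    case (step y z)
    have "y \<in> F" "z \<in> F"
      using final_class_reachable[OF assms(1,2)] step(1,2) rtrancl_into_rtrancl[OF step(1,2)] by blast+
    then have "(y, z) \<in> matrix_arcs P \<inter> F \<times> F" using step(2) by blast
    then show ?case using step(3) by (rule rtrancl_into_rtrancl[rotated])
  qed simp
qed

lemma final_class_entry_outside:
  assumes "final_class P F" "i \<in> F" "j \<notin> F"
  shows "P $ i $ j = 0"
proof (rule ccontr)
  assume "P $ i $ j \<noteq> 0"
  then have "(i, j) \<in> (matrix_arcs P)\<^sup>*" by (auto simp: matrix_arcs_def)
  then show False using final_class_reachable[OF assms(1,2)] assms(3) by blast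
qed

lemma final_class_matrix_vector:
  assumes "final_class P F" "i \<in> F"
  shows "(P *v x) $ i = (\<Sum>j\<in>F. P $ i $ j * x $ j)"
  unfolding matrix_vector_mult_def vec_lambda_beta
  using final_class_entry_outside[OF assms] by (intro sum.mono_neutral_right) auto

lemma final_class_reachableI:
  assumes "\<And>j. (i, j) \<in> (matrix_arcs P)\<^sup>* \<Longrightarrow> (j, i) \<in> (matrix_arcs P)\<^sup>*"
  shows "final_class P {j. (i, j) \<in> (matrix_arcs P)\<^sup>*}"
proof -
  let ?A = "matrix_arcs P"
  have "{j. (i, j) \<in> ?A\<^sup>*} = {(i, j). i \<in> UNIV \<and> j \<in> UNIV \<and> (i, j) \<in> ?A\<^sup>* \<and> (j, i) \<in> ?A\<^sup>*} `` {i}"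
    using assms by auto
  then have "{j. (i, j) \<in> ?A\<^sup>*} \<in> classes UNIV ?A"
    unfolding classes_def by (metis (no_types, lifting) UNIV_I quotientI)
  then show ?thesis unfolding final_class_def by (auto intro: rtrancl_trans)
qed

text \<open>
  The set of nodes reachable from \<open>j\<close> keeps all its mass under \<open>P\<close>, so no node of the support
  outside it can send mass into it; hence \<open>i\<close> lies in it as soon as \<open>j\<close> is reachable from \<open>i\<close>.
\<close>

lemma stationary_measure_final_class:
  fixes P :: "real ^ 'n::finite ^ 'n"
  assumes nonneg: "\<And>i j. 0 \<le> P $ i $ j" and row: "\<And>i. (\<Sum>j\<in>UNIV. P $ i $ j) \<le> 1"
    and m: "\<And>i. 0 \<le> m i" "\<And>j. (\<Sum>i\<in>UNIV. m i * P $ i $ j) = m j" and i: "0 < m i"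
  obtains F where "final_class P F" "stochastic_on F P" "i \<in> F"
proof -
  let ?A = "matrix_arcs P"
  have supp_closed: "0 < m k" if "(i, k) \<in> ?A\<^sup>*" for k
    using that
  proof (induction rule: rtrancl_induct)
    case (step k l)
    then have "0 < m k * P $ k $ l"
      using nonneg[of k l] by (simp add: matrix_arcs_def)
    also have "\<dots> \<le> (\<Sum>k\<in>UNIV. m k * P $ k $ l)"
      using m(1) nonneg by (intro member_le_sum) auto
    finally show ?case by (simp add: m(2))
  qed (rule i)
  \<comment> \<open>Stationarity preserves the total mass, so the row deficits weighted by
    \<open>m\<close> sum to zero and every row in the support has sum 1.\<close>
  have "(\<Sum>k\<in>UNIV. m k * (1 - (\<Sum>l\<in>UNIV. P $ k $ l))) =
      (\<Sum>k\<in>UNIV. m k) - (\<Sum>l\<in>UNIV. \<Sum>k\<in>UNIV. m k * P $ k $ l)"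
    by (subst sum.swap) (simp add: right_diff_distrib sum_subtractf sum_distrib_left)
  also have "\<dots> = 0" by (simp add: m(2))
  finally have "m k * (1 - (\<Sum>l\<in>UNIV. P $ k $ l)) = 0" for k
    using m(1) row by (subst (asm) sum_nonneg_eq_0_iff) auto
  then have row1: "(\<Sum>l\<in>UNIV. P $ k $ l) = 1" if "0 < m k" for k
    using that by (metis eq_iff_diff_eq_0 less_irrefl mult_eq_0_iff)
  have return: "(j, i) \<in> ?A\<^sup>*" if ij: "(i, j) \<in> ?A\<^sup>*" for j
  proof -
    define T where "T = {k. (j, k) \<in> ?A\<^sup>*}"
    have T_supp: "0 < m k" if "k \<in> T" for k
      using that ij supp_closed unfolding T_def by (auto intro: rtrancl_trans)
    have out: "P $ k $ l = 0" if "k \<in> T" "l \<notin> T" for k l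
      using that unfolding T_def by (auto simp: matrix_arcs_def intro: rtrancl_into_rtrancl)
    have T1: "(\<Sum>l\<in>T. P $ k $ l) = 1" if "k \<in> T" for k
    proof -
      have "(\<Sum>l\<in>T. P $ k $ l) = (\<Sum>l\<in>UNIV. P $ k $ l)"
        using out that by (intro sum.mono_neutral_left) auto
      then show ?thesis using row1 T_supp that by simp
    qed
    have "(\<Sum>l\<in>T. m l) = (\<Sum>l\<in>T. \<Sum>k\<in>UNIV. m k * P $ k $ l)" by (simp add: m(2))
    also have "\<dots> = (\<Sum>k\<in>UNIV. m k * (\<Sum>l\<in>T. P $ k $ l))"
      by (subst sum.swap) (simp add: sum_distrib_left)
    also have "\<dots> = (\<Sum>k\<in>T. m k * (\<Sum>l\<in>T. P $ k $ l)) + (\<Sum>k\<in>-T. m k * (\<Sum>l\<in>T. P $ k $ l))"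
      by (metis (no_types, lifting) Compl_eq_Diff_UNIV add.commute finite subset_UNIV sum.subset_diff)
    also have "(\<Sum>k\<in>T. m k * (\<Sum>l\<in>T. P $ k $ l)) = (\<Sum>k\<in>T. m k)" using T1 by simp
    finally have "(\<Sum>k\<in>-T. m k * (\<Sum>l\<in>T. P $ k $ l)) = 0" by simp
    then have "\<forall>k\<in>-T. m k * (\<Sum>l\<in>T. P $ k $ l) = 0"
      using m(1) nonneg by (subst (asm) sum_nonneg_eq_0_iff) (auto intro!: mult_nonneg_nonneg sum_nonneg)
    then have in0: "P $ k $ l = 0" if "k \<notin> T" "l \<in> T" "0 < m k" for k l
      using that nonneg by (metis ComplI finite less_irrefl mult_eq_0_iff sum_nonneg_eq_0_iff)
    have "k \<in> T \<longrightarrow> i \<in> T" if "(i, k) \<in> ?A\<^sup>*" for k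
      using that
    proof (induction rule: rtrancl_induct)
      case (step k l)
      then show ?case using in0[of k l] supp_closed[of k] by (auto simp: matrix_arcs_def)
    qed simp
    from this[OF ij] have "i \<in> T" by (simp add: T_def)
    then show ?thesis by (simp add: T_def)
  qed
  have fc: "final_class P {j. (i, j) \<in> ?A\<^sup>*}" using return by (rule final_class_reachableI)
  moreover have "stochastic_on {j. (i, j) \<in> ?A\<^sup>*} P"
    unfolding stochastic_on_def
  proof (intro ballI conjI nonneg)
    fix k assume k: "k \<in> {j. (i, j) \<in> ?A\<^sup>*}"
    have "(\<Sum>l\<in>{j. (i, j) \<in> ?A\<^sup>*}. P $ k $ l) = (\<Sum>l\<in>UNIV. P $ k $ l)"
      using final_class_entry_outside[OF fc k] by (intro sum.mono_neutral_left) auto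
    then show "(\<Sum>l\<in>{j. (i, j) \<in> ?A\<^sup>*}. P $ k $ l) = 1" using k supp_closed row1 by simp
  qed
  ultimately show ?thesis using that by blast
qed

text \<open>The existence part of Perron-Frobenius. A stochastic matrix fixes the constant vector,
  so its transpose has a nonzero fixed vector too. Its absolute value \<open>m\<close> satisfies
  \<open>m \<le> m Q\<close>, with equality because both sides have the same total mass. Positivity
  then spreads along the arcs inside \<open>F\<close>.\<close>

lemma final_class_stationary_measure:
  fixes P :: "real ^ 'n::finite ^ 'n"
  assumes "final_class P F" "stochastic_on F P"
  obtains m where "\<And>i. i \<in> F \<Longrightarrow> 0 < m i" "\<And>j. j \<in> F \<Longrightarrow> (\<Sum>i\<in>F. m i * P $ i $ j) = m j"
proof -
  obtain i0 where i0: "i0 \<in> F"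
    using assms(1) unfolding final_class_def classes_def quotient_def by blast
  have nonneg: "0 \<le> P $ i $ j" if "i \<in> F" "j \<in> F" for i j
    using assms(2) that by (simp add: stochastic_on_def)
  \<comment> \<open>Sending all rows outside \<open>F\<close> to \<open>i0\<close> makes the whole
    matrix stochastic, while its columns outside \<open>F\<close> vanish and confine stationary
    measures to \<open>F\<close>.\<close>
  define Q :: "real ^ 'n ^ 'n" where
    "Q = (\<chi> i j. if i \<in> F then (if j \<in> F then P $ i $ j else 0) else if j = i0 then 1 else 0)"
  have Q0: "0 \<le> Q $ i $ j" for i j using nonneg by (simp add: Q_def)
  have Q1: "(\<Sum>j\<in>UNIV. Q $ i $ j) = 1" for i
    using assms(2) by (simp add: Q_def stochastic_on_def if_distrib[of "\<lambda>g. sum g UNIV"] sum.If_cases)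
  have Qout: "Q $ i $ j = 0" if "j \<notin> F" for i j using that i0 by (auto simp: Q_def)
  let ?A = "Q - mat 1"
  have "?A *v 1 = 0"
    using Q1 by (simp add: vec_eq_iff matrix_vector_mult_def sum_subtractf mat_def)
  then have "\<not> (\<exists>B. B ** ?A = mat 1)"
    unfolding matrix_left_invertible_ker by (metis zero_neq_one)
  then have "\<not> (\<exists>B. B ** transpose ?A = mat 1)"
    unfolding left_invertible_transpose by (metis matrix_left_right_inverse)
  then obtain x where x: "x \<noteq> 0" "transpose ?A *v x = 0"
    unfolding matrix_left_invertible_ker by blast
  have xQ: "(\<Sum>i\<in>UNIV. x $ i * Q $ i $ j) = x $ j" for j
  proof -
    have "(transpose ?A *v x) $ j = 0" using x(2) by simp
    then have "(\<Sum>i\<in>UNIV. x $ i * Q $ i $ j) - (\<Sum>i\<in>UNIV. x $ i * (if i = j then 1 else 0)) = 0"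
      by (simp add: matrix_vector_mult_def transpose_def mat_def right_diff_distrib sum_subtractf mult.commute)
    then show ?thesis by (simp add: if_distrib[of "\<lambda>c. _ * c"] cong: if_cong)
  qed
  define m where "m i = \<bar>x $ i\<bar>" for i
  have m0: "0 \<le> m i" for i by (simp add: m_def)
  have "m j \<le> (\<Sum>i\<in>UNIV. m i * Q $ i $ j)" for j
    using sum_abs[of "\<lambda>i. x $ i * Q $ i $ j" UNIV] Q0 by (simp add: xQ m_def abs_mult)
  moreover have "(\<Sum>j\<in>UNIV. (\<Sum>i\<in>UNIV. m i * Q $ i $ j) - m j) = 0"
    by (subst sum_subtractf, subst sum.swap) (simp add: Q1 flip: sum_distrib_left)
  ultimately have mQ: "(\<Sum>i\<in>UNIV. m i * Q $ i $ j) = m j" for j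
    by (subst (asm) sum_nonneg_eq_0_iff) auto
  have mout: "m j = 0" if "j \<notin> F" for j
    using mQ[of j] Qout[OF that] by simp
  have mP: "(\<Sum>i\<in>F. m i * P $ i $ j) = m j" if "j \<in> F" for j
  proof -
    have "(\<Sum>i\<in>F. m i * P $ i $ j) = (\<Sum>i\<in>UNIV. m i * Q $ i $ j)"
      using that mout by (intro sum.mono_neutral_cong_left) (auto simp: Q_def)
    then show ?thesis using mQ by simp
  qed
  obtain i where "x $ i \<noteq> 0" using x(1) by (auto simp: vec_eq_iff)
  then have i: "0 < m i" "i \<in> F" using mout[of i] by (auto simp: m_def)
  have "0 < m j" if "j \<in> F" for j
  proof -
    have "(i, j) \<in> (matrix_arcs P \<inter> F \<times> F)\<^sup>*"
      using final_class_connected assms(1) i(2) that by blast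
    then show ?thesis
    proof (induction rule: rtrancl_induct)
      case (step k l)
      then have kl: "k \<in> F" "l \<in> F" "P $ k $ l \<noteq> 0" by (auto simp: matrix_arcs_def)
      then have "0 < m k * P $ k $ l" using nonneg[of k l] step.IH by simp
      also have "\<dots> \<le> (\<Sum>k\<in>F. m k * P $ k $ l)"
        using kl nonneg m0 by (intro member_le_sum) auto
      finally show ?case using mP kl by simp
    qed (rule i)
  qed
  then show ?thesis using mP that by blast
qed

section \<open>Convex monotone subhomogeneous maps\<close>

locale convex_monotone =
  fixes f :: "real ^ 'n::finite \<Rightarrow> real ^ 'n"
  assumes convex: "convex_map f" and mono: "mono f" and subhom: "subhomogeneous f"
begin

lemma subdiff_componentI:
  assumes "\<And>i z. (P *v (z - x)) $ i \<le> f z $ i - f x $ i"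
  shows "P \<in> subdiff f x"
  using assms by (simp add: subdiff_def less_eq_vec_def)

lemma subdiff_component:
  assumes "P \<in> subdiff f x"
  shows "(P *v (z - x)) $ i \<le> f z $ i - f x $ i"
  using assms by (simp add: subdiff_def less_eq_vec_def)

lemma subdiff_nonempty: "\<exists>P. P \<in> subdiff f x"
proof -
  have "\<exists>p. \<forall>z. f x $ i + p \<bullet> (z - x) \<le> f z $ i" for i
    using subgradient_exists[of "\<lambda>z. f z $ i" x] convex unfolding convex_map_def by metis
  then obtain p where p: "\<And>i z. f x $ i + p i \<bullet> (z - x) \<le> f z $ i" by metis
  have "(\<chi> i. p i) \<in> subdiff f x"
    using p by (intro subdiff_componentI) (simp add: matrix_vector_mul_component algebra_simps)
  then show ?thesis by blast
qed

lemma monoD': "x \<le> y \<Longrightarrow> f x $ i \<le> f y $ i"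
  using mono by (simp add: mono_def less_eq_vec_def)

text \<open>The one place where subhomogeneity enters; nonexpansiveness and the bound on the row
  sums of subgradients both come from here.\<close>

lemma add_const:
  assumes "0 \<le> e" "\<And>i. x $ i \<le> y $ i + e"
  shows "f x $ i \<le> f y $ i + e"
proof -
  have "f x $ i \<le> f (vec e + y) $ i"
    using assms(2) by (intro monoD') (simp add: less_eq_vec_def add.commute)
  also have "\<dots> \<le> (vec e + f y) $ i"
    using subhom assms(1) unfolding subhomogeneous_def less_eq_vec_def by blast
  finally show ?thesis by simp
qed

lemma nonexpansive:
  assumes "\<And>i. \<bar>x $ i - y $ i\<bar> \<le> e"
  shows "\<bar>f x $ i - f y $ i\<bar> \<le> e"
proof -
  \<comment> \<open>Index types are nonempty, so an arbitrary coordinate will do.\<close>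
  have "0 \<le> e" using assms[of undefined] by linarith
  then show ?thesis
    using add_const[of e x y i] add_const[of e y x i] assms by (fastforce simp: abs_le_iff algebra_simps)
qed

lemma nonexpansive_funpow:
  assumes "\<And>i. \<bar>x $ i - y $ i\<bar> \<le> e"
  shows "\<bar>(f ^^ k) x $ i - (f ^^ k) y $ i\<bar> \<le> e"
  using assms
proof (induction k arbitrary: i)
  case (Suc k)
  then show ?case using nonexpansive[of "(f ^^ k) x" "(f ^^ k) y" e i] by simp
qed simp

lemma continuous: "continuous_on UNIV f"
proof -
  have "dist (f x $ i) (f y $ i) \<le> 1 * dist x y" for x y i
    using nonexpansive[of x y "norm (x - y)" i] component_le_norm_cart[of "x - y"]
    by (simp add: dist_norm)
  then have "continuous_on UNIV (\<lambda>x. f x $ i)" for i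
    by (intro lipschitz_on_continuous_on[of 1]) (simp add: lipschitz_on_def)
  then have "continuous_on UNIV (\<lambda>x. \<chi> i. f x $ i)" by (rule continuous_on_vec_lambda)
  then show ?thesis by simp
qed

lemma continuous_funpow: "continuous_on UNIV (f ^^ k)"
proof (induction k)
  case (Suc k)
  then show ?case using continuous_on_compose2[OF continuous Suc] by (simp add: o_def)
qed (simp add: id_def)

lemma tendsto_map: "(g \<longlongrightarrow> x) F \<Longrightarrow> ((\<lambda>k. f (g k)) \<longlongrightarrow> f x) F"
  using continuous by (simp add: continuous_on_eq_continuous_at isCont_tendsto_compose)

text \<open>Lowering coordinate \<open>j\<close> of \<open>x\<close> cannot raise \<open>f\<close>,
  and the subgradient inequality turns this into a sign for the entry.\<close>

lemma subdiff_nonneg: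
  assumes "P \<in> subdiff f x"
  shows "0 \<le> P $ i $ j"
proof -
  have "(P *v (- axis j 1)) $ i \<le> f (x - axis j 1) $ i - f x $ i"
    using subdiff_component[OF assms, of "x - axis j 1" i] by simp
  also have "f (x - axis j 1) $ i \<le> f x $ i"
    by (intro monoD') (simp add: less_eq_vec_def axis_def)
  finally show ?thesis
    by (simp add: matrix_vector_mult_def axis_def sum_negf if_distrib[of "\<lambda>c. _ * c"] cong: if_cong)
qed

lemma subdiff_row_le:
  assumes "P \<in> subdiff f x"
  shows "(\<Sum>j\<in>UNIV. P $ i $ j) \<le> 1"
proof -
  have "(P *v 1) $ i \<le> f (vec 1 + x) $ i - f x $ i"
    using subdiff_component[OF assms, of "vec 1 + x" i] by (simp add: one_vec_def vec_def)
  also have "\<dots> \<le> 1"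
    using add_const[of 1 "vec 1 + x" x i] by simp
  finally show ?thesis by (simp add: matrix_vector_mult_def)
qed

end

section \<open>Comparison of backward orbits\<close>

lemma sum_mult_matrix_vector:
  fixes Q :: "real ^ 'n::finite ^ 'n"
  shows "(\<Sum>j\<in>UNIV. (\<Sum>i\<in>UNIV. m i * Q $ i $ j) * x $ j) = (\<Sum>i\<in>UNIV. m i * (Q *v x) $ i)"
  unfolding matrix_vector_mult_def vec_lambda_beta sum_distrib_left sum_distrib_right mult.assoc
  by (rule sum.swap)

lemma compact_attains_inf_finite:
  fixes h :: "'i \<Rightarrow> 'a::topological_space \<Rightarrow> real"
  assumes "compact Y" "Y \<noteq> {}" "finite I" "I \<noteq> {}" "\<And>i. i \<in> I \<Longrightarrow> continuous_on Y (h i)"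
  obtains i y where "i \<in> I" "y \<in> Y" "\<And>i' y'. i' \<in> I \<Longrightarrow> y' \<in> Y \<Longrightarrow> h i y \<le> h i' y'"
proof -
  have "\<exists>y\<in>Y. \<forall>y'\<in>Y. h i y \<le> h i y'" if "i \<in> I" for i
    using assms that by (intro continuous_attains_inf) auto
  then obtain y where y: "\<And>i. i \<in> I \<Longrightarrow> y i \<in> Y" "\<And>i y'. i \<in> I \<Longrightarrow> y' \<in> Y \<Longrightarrow> h i (y i) \<le> h i y'"
    by metis
  have "finite ((\<lambda>i. h i (y i)) ` I)" "(\<lambda>i. h i (y i)) ` I \<noteq> {}" using assms(3,4) by auto
  then obtain i where i: "i \<in> I" "\<And>i'. i' \<in> I \<Longrightarrow> h i (y i) \<le> h i' (y i')"
    using ex_min_if_finite[of "(\<lambda>i. h i (y i)) ` I"] by (auto simp: not_less)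
  show ?thesis
  proof (rule that[OF i(1) y(1)[OF i(1)]])
    show "h i (y i) \<le> h i' y'" if "i' \<in> I" "y' \<in> Y" for i' y'
      using i(2)[OF that(1)] y(2)[OF that] by (rule order_trans)
  qed
qed

locale convex_monotone_fixpoint = convex_monotone f for f :: "real ^ 'n::finite \<Rightarrow> real ^ 'n" +
  fixes v :: "real ^ 'n"
  assumes fixpoint: "f v = v"
begin

definition crit_pair :: "real ^ 'n ^ 'n \<Rightarrow> 'n set \<Rightarrow> bool" where
  "crit_pair P F \<longleftrightarrow> P \<in> subdiff f v \<and> final_class P F \<and> stochastic_on F P"

lemma crit_nodes_iff: "i \<in> crit_nodes f v \<longleftrightarrow> (\<exists>P F. crit_pair P F \<and> i \<in> F)"
  by (auto simp: crit_nodes_def crit_pair_def)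

lemma crit_arcs_iff:
  "(i, j) \<in> crit_arcs f v \<longleftrightarrow> (\<exists>P F. crit_pair P F \<and> i \<in> F \<and> j \<in> F \<and> P $ i $ j \<noteq> 0)"
  by (auto simp: crit_arcs_def crit_pair_def matrix_arcs_def)

text \<open>Dividing each row of the flow \<open>M\<close> by its weight gives a subgradient at
  \<open>v\<close> for which \<open>\<mu>\<close> is stationary. The formulation with
  \<open>M\<close> and \<open>\<mu>\<close>, free of division, passes to limits and also fits the
  multipliers of Farkas' lemma.\<close>

lemma stationary_flow_critical:
  fixes M :: "real ^ 'n ^ 'n"
  assumes \<mu>: "\<And>i. 0 \<le> \<mu> i"
    and le: "\<And>i z. (M *v (z - v)) $ i \<le> \<mu> i * (f z $ i - v $ i)"
    and flow: "\<And>j. (\<Sum>i\<in>UNIV. M $ i $ j) = \<mu> j" and i: "0 < \<mu> i"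
  obtains P F where "crit_pair P F" "i \<in> F" "\<And>j. M $ i $ j = \<mu> i * P $ i $ j"
proof -
  \<comment> \<open>Rows without mass are filled from an arbitrary subgradient, so that
    \<open>P\<close> is one as well.\<close>
  obtain P0 where P0: "P0 \<in> subdiff f v" using subdiff_nonempty by blast
  define P :: "real ^ 'n ^ 'n" where "P = (\<chi> i j. if 0 < \<mu> i then M $ i $ j / \<mu> i else P0 $ i $ j)"
  have P: "P \<in> subdiff f v"
  proof (rule subdiff_componentI)
    fix i z
    show "(P *v (z - v)) $ i \<le> f z $ i - f v $ i"
    proof (cases "0 < \<mu> i")
      case True
      then have "(P *v (z - v)) $ i = (M *v (z - v)) $ i / \<mu> i"
        by (simp add: P_def matrix_vector_mult_def sum_divide_distrib)
      then show ?thesis using le[of z i] True by (simp add: fixpoint divide_le_eq mult.commute)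
    next
      case False
      then have "(P *v (z - v)) $ i = (P0 *v (z - v)) $ i"
        by (simp add: P_def matrix_vector_mult_def)
      then show ?thesis using subdiff_component[OF P0] by simp
    qed
  qed
  \<comment> \<open>A linear form that is nonpositive in both directions vanishes, so a node without
    mass emits no flow.\<close>
  have M0: "M $ i $ j = 0" if "\<mu> i = 0" for i j
  proof -
    have "M $ i $ j * s \<le> 0" for s
      using le[of "v + axis j s" i] that
      by (simp add: matrix_vector_mult_def axis_def if_distrib[of "\<lambda>c. _ * c"] cong: if_cong)
    from this[of 1] this[of "-1"] show ?thesis by simp
  qed
  have M: "M $ i $ j = \<mu> i * P $ i $ j" for i j
    using \<mu>[of i] M0[of i j] by (cases "\<mu> i = 0") (auto simp: P_def)
  obtain F where "final_class P F" "stochastic_on F P" "i \<in> F"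
  proof (rule stationary_measure_final_class[of P \<mu> i])
    show "(\<Sum>i\<in>UNIV. \<mu> i * P $ i $ j) = \<mu> j" for j using flow by (simp add: M)
  qed (use P subdiff_nonneg subdiff_row_le \<mu> i in auto)
  then show ?thesis using that P M unfolding crit_pair_def by blast
qed

text \<open>
  At a pair of points of \<open>Y\<close> and a node where \<open>b\<^sub>i - a\<^sub>i\<close> attains its minimum \<open>D < 0\<close>, the
  subgradients at the successive backward images of \<open>a\<close> transport the unit mass \<open>m\<^sub>k\<close>, which must
  remain on the nodes where \<open>D\<close> is attained.  The errors \<open>\<epsilon>\<close> made by viewing these subgradients as
  subgradients at \<open>v\<close> have a telescoping sum, so a limit of Cesaro means is a stationary flow.
\<close>

lemma backward_comparison:
  assumes compact: "compact Y"
    and pred: "\<And>a b. (a, b) \<in> Y \<Longrightarrow> \<exists>a' b'. (a', b') \<in> Y \<and> f a' = a \<and> f b' = b"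
    and crit: "\<And>a b i. (a, b) \<in> Y \<Longrightarrow> i \<in> crit_nodes f v \<Longrightarrow> a $ i \<le> b $ i"
    and ab: "(a, b) \<in> Y"
  shows "a \<le> b"
proof (rule ccontr)
  assume "\<not> a \<le> b"
  then obtain i1 where i1: "b $ i1 - a $ i1 < 0" by (auto simp: less_eq_vec_def not_le)
  have cont: "continuous_on Y (\<lambda>y. snd y $ i - fst y $ i)" for i by (intro continuous_intros)
  have "Y \<noteq> {}" using ab by blast
  obtain i0 y0 where y0: "y0 \<in> Y"
      and min: "\<And>i y. y \<in> Y \<Longrightarrow> snd y0 $ i0 - fst y0 $ i0 \<le> snd y $ i - fst y $ i"
    by (rule compact_attains_inf_finite[where h = "\<lambda>i y. snd y $ i - fst y $ i", OF compact \<open>Y \<noteq> {}\<close> finite UNIV_not_empty cont]) blast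
  define D where "D = snd y0 $ i0 - fst y0 $ i0"
  have D: "D \<le> snd y $ i - fst y $ i" if "y \<in> Y" for y i using min[OF that] by (simp add: D_def)
  have D0: "D < 0" using D[OF ab, of i1] i1 by simp
  obtain s where s: "\<And>y. y \<in> Y \<Longrightarrow> s y \<in> Y \<and> f (fst (s y)) = fst y \<and> f (snd (s y)) = snd y"
  proof -
    have "\<exists>y'\<in>Y. f (fst y') = fst y \<and> f (snd y') = snd y" if "y \<in> Y" for y
      using pred[of "fst y" "snd y"] that by force
    then show ?thesis using that by metis
  qed
  define a b where "a k = fst ((s ^^ k) y0)" and "b k = snd ((s ^^ k) y0)" for k
  have "(s ^^ k) y0 \<in> Y" for k
    by (induction k) (use y0 s in auto)
  then have Y: "(a k, b k) \<in> Y" and fa: "f (a (Suc k)) = a k" and fb: "f (b (Suc k)) = b k" for k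
    using s by (auto simp: a_def b_def)
  define w where "w k = b k - a k" for k
  have wD: "D \<le> w k $ i" for k i using D[OF Y] by (simp add: w_def)
  define Q where "Q k = (SOME P. P \<in> subdiff f (a (Suc k)))" for k
  have Q: "Q k \<in> subdiff f (a (Suc k))" for k
    unfolding Q_def using subdiff_nonempty by (rule someI_ex)
  define m where "m = rec_nat (\<lambda>i. if i = i0 then 1 else (0::real)) (\<lambda>k mk j. \<Sum>i\<in>UNIV. mk i * Q k $ i $ j)"
  have m_0: "m 0 = (\<lambda>i. if i = i0 then 1 else 0)" by (simp add: m_def)
  have m_Suc: "m (Suc k) j = (\<Sum>i\<in>UNIV. m k i * Q k $ i $ j)" for k j by (simp add: m_def)
  have m0: "0 \<le> m k i" for k i
    by (induction k arbitrary: i) (auto simp: m_0 m_Suc intro!: sum_nonneg mult_nonneg_nonneg subdiff_nonneg[OF Q])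
  have m_push: "(\<Sum>j\<in>UNIV. m (Suc k) j * x $ j) = (\<Sum>i\<in>UNIV. m k i * (Q k *v x) $ i)" for k x
    unfolding m_Suc by (rule sum_mult_matrix_vector)
  have mass_le: "(\<Sum>i\<in>UNIV. m k i) \<le> 1" for k
  proof (induction k)
    case (Suc k)
    have "(\<Sum>j\<in>UNIV. m (Suc k) j) = (\<Sum>i\<in>UNIV. m k i * (\<Sum>j\<in>UNIV. Q k $ i $ j))"
      unfolding m_Suc by (subst sum.swap) (simp add: sum_distrib_left)
    also have "\<dots> \<le> (\<Sum>i\<in>UNIV. m k i * 1)"
      by (intro sum_mono mult_left_mono m0 subdiff_row_le[OF Q])
    finally show ?case using Suc by simp
  qed (simp add: m_0)
  \<comment> \<open>The subgradient at \<open>a (Suc k)\<close> underestimates the increment of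
    \<open>f\<close> from \<open>a (Suc k)\<close> to \<open>b (Suc k)\<close>, so transport along
    backward orbits cannot raise the average of \<open>w\<close>.\<close>
  have mw: "(\<Sum>i\<in>UNIV. m k i * w k $ i) \<le> D" for k
  proof (induction k)
    case 0
    then show ?case by (simp add: m_0 w_def a_def b_def D_def if_distrib[of "\<lambda>c. c * _"] cong: if_cong)
  next
    case (Suc k)
    have "(\<Sum>i\<in>UNIV. m (Suc k) i * w (Suc k) $ i) \<le> (\<Sum>i\<in>UNIV. m k i * w k $ i)"
      unfolding m_push
      using subdiff_component[OF Q, of _ "b (Suc _)"] m0
      by (intro sum_mono mult_left_mono) (auto simp: w_def fa fb)
    then show ?case using Suc by simp
  qed
  have Dm: "(\<Sum>i\<in>UNIV. m k i * D) \<le> (\<Sum>i\<in>UNIV. m k i * w k $ i)" for k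
    by (intro sum_mono mult_left_mono m0 wD)
  \<comment> \<open>Since \<open>D < 0\<close>, a loss of mass would lift the average of
    \<open>w\<close> strictly above \<open>D\<close>.\<close>
  have mass: "(\<Sum>i\<in>UNIV. m k i) = 1" for k
  proof -
    have "(\<Sum>i\<in>UNIV. m k i) * D \<le> 1 * D"
      using Dm[of k] mw[of k] by (simp add: sum_distrib_right)
    then show ?thesis using mass_le[of k] D0 by (simp add: mult_le_cancel_right)
  qed
  have supp: "w k $ i = D" if "m k i \<noteq> 0" for k i
  proof -
    have "(\<Sum>i\<in>UNIV. m k i * (w k $ i - D)) = (\<Sum>i\<in>UNIV. m k i * w k $ i) - D"
      by (simp add: right_diff_distrib sum_subtractf mass flip: sum_distrib_right)
    then have "(\<Sum>i\<in>UNIV. m k i * (w k $ i - D)) = 0"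
      using mw[of k] sum_nonneg[of UNIV "\<lambda>i. m k i * (w k $ i - D)"] m0 wD by fastforce
    then have "m k i * (w k $ i - D) = 0"
      using m0 wD by (subst (asm) sum_nonneg_eq_0_iff) auto
    then show ?thesis using that by simp
  qed
  \<comment> \<open>On critical nodes \<open>w \<ge> 0 > D\<close>, so mass never reaches
    them.\<close>
  have m_crit: "m k i = 0" if "i \<in> crit_nodes f v" for k i
    using supp[of k i] crit[OF Y that, of k] D0 by (fastforce simp: w_def)
  have m1: "m k i \<le> 1" for k i
    using mass[of k] m0 member_le_sum[of i UNIV "m k"] by simp
  have Q0: "0 \<le> Q k $ i $ j" for k i j by (rule subdiff_nonneg[OF Q])
  have Q1: "Q k $ i $ j \<le> 1" for k i j
    using member_le_sum[of j UNIV "\<lambda>j. Q k $ i $ j"] Q0 subdiff_row_le[OF Q[of k], of i] by fastforce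
  have "bounded Y" using compact compact_imp_bounded by blast
  then obtain B0 where B0: "\<And>y. y \<in> Y \<Longrightarrow> norm y \<le> B0" unfolding bounded_iff by blast
  define B where "B = norm v + B0"
  have B: "\<bar>v $ i - a k $ i\<bar> \<le> B" for i k
  proof -
    have "norm (a k) \<le> B0" using B0[OF Y] norm_fst_le[of "a k" "b k"] by (meson order_trans)
    then show ?thesis
      using component_le_norm_cart[of v i] component_le_norm_cart[of "a k" i] unfolding B_def by linarith
  qed
  define \<epsilon> where "\<epsilon> k i = v $ i - a k $ i - (Q k *v (v - a (Suc k))) $ i" for k i
  have \<epsilon>0: "0 \<le> \<epsilon> k i" for k i
    using subdiff_component[OF Q[of k], of v i] by (simp add: \<epsilon>_def fa fixpoint)
  have Q\<epsilon>: "(Q k *v (z - v)) $ i \<le> f z $ i - v $ i + \<epsilon> k i" for k i z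
  proof -
    have "Q k *v (z - a (Suc k)) = Q k *v (z - v) + Q k *v (v - a (Suc k))"
      by (simp flip: matrix_vector_right_distrib)
    then show ?thesis using subdiff_component[OF Q[of k], of z i] by (simp add: \<epsilon>_def fa)
  qed
  \<comment> \<open>The potential behind the telescoping: its drop from \<open>k\<close> to
    \<open>Suc k\<close> is the weighted error of that step, and compactness of \<open>Y\<close>
    bounds it.\<close>
  define G where "G k = (\<Sum>i\<in>UNIV. m k i * (v $ i - a k $ i))" for k
  have GB: "\<bar>G k\<bar> \<le> B" for k
  proof -
    have "\<bar>G k\<bar> \<le> (\<Sum>i\<in>UNIV. \<bar>m k i * (v $ i - a k $ i)\<bar>)" unfolding G_def by (rule sum_abs)
    also have "\<dots> \<le> (\<Sum>i\<in>UNIV. m k i * B)" using m0 B by (intro sum_mono) (auto simp: abs_mult intro: mult_left_mono)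
    finally show ?thesis by (simp add: mass flip: sum_distrib_right)
  qed
  have G_diff: "(\<Sum>i\<in>UNIV. m k i * \<epsilon> k i) = G k - G (Suc k)" for k
    using m_push[of k "v - a (Suc k)"] by (simp add: \<epsilon>_def G_def right_diff_distrib[of "m k _" "_ - _"] sum_subtractf)
  have err: "(\<Sum>k<n. m k i * \<epsilon> k i) \<le> 2 * B" for n i
  proof -
    have "(\<Sum>k<n. m k i * \<epsilon> k i) \<le> (\<Sum>k<n. \<Sum>i\<in>UNIV. m k i * \<epsilon> k i)"
      using m0 \<epsilon>0 by (intro sum_mono member_le_sum) auto
    also have "\<dots> = G 0 - G n" unfolding G_diff by (rule sum_lessThan_telescope')
    finally show ?thesis using GB[of 0] GB[of n] by linarith
  qed
  \<comment> \<open>Averages run over \<open>Suc t\<close> terms to keep the denominator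
    positive.\<close>
  define \<mu> where "\<mu> t i = (\<Sum>k<Suc t. m k i) / real (Suc t)" for t i
  define M :: "nat \<Rightarrow> real ^ 'n ^ 'n" where
    "M t = (\<chi> i j. (\<Sum>k<Suc t. m k i * Q k $ i $ j) / real (Suc t))" for t
  have M_le: "(M t *v (z - v)) $ i \<le> \<mu> t i * (f z $ i - v $ i) + 2 * B / real (Suc t)" for t z i
  proof -
    have "(M t *v (z - v)) $ i = (\<Sum>k<Suc t. m k i * (Q k *v (z - v)) $ i) / real (Suc t)"
      unfolding M_def matrix_vector_mult_def vec_lambda_beta sum_distrib_left sum_distrib_right
        sum_divide_distrib times_divide_eq_left mult.assoc
      by (rule sum.swap)
    also have "\<dots> \<le> (\<Sum>k<Suc t. m k i * (f z $ i - v $ i + \<epsilon> k i)) / real (Suc t)"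
      by (intro divide_right_mono sum_mono mult_left_mono Q\<epsilon> m0) auto
    also have "\<dots> = \<mu> t i * (f z $ i - v $ i) + (\<Sum>k<Suc t. m k i * \<epsilon> k i) / real (Suc t)"
      by (simp only: distrib_left sum.distrib add_divide_distrib \<mu>_def sum_distrib_right times_divide_eq_left)
    also have "\<dots> \<le> \<mu> t i * (f z $ i - v $ i) + 2 * B / real (Suc t)"
      by (intro add_left_mono divide_right_mono err) auto
    finally show ?thesis .
  qed
  \<comment> \<open>Stationarity of the averages fails only by the two end terms of the sum, divided
    by \<open>Suc t\<close>.\<close>
  have M_col: "(\<Sum>i\<in>UNIV. M t $ i $ j) - (m (Suc t) j - m 0 j) / real (Suc t) = \<mu> t j" for t j
  proof -
    have "(\<Sum>i\<in>UNIV. M t $ i $ j) = (\<Sum>k<Suc t. m (Suc k) j) / real (Suc t)"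
      unfolding M_def vec_lambda_beta m_Suc by (subst sum.swap) (rule sum_divide_distrib[symmetric])
    moreover have "(\<Sum>k<Suc t. m (Suc k) j) = (\<Sum>k<Suc t. m k j) + (m (Suc t) j - m 0 j)"
      using sum_lessThan_telescope[of "\<lambda>k. m k j" "Suc t"] by (simp only: sum_subtractf)
    ultimately show ?thesis by (simp only: \<mu>_def add_divide_distrib add_diff_cancel_right')
  qed
  have "M t $ i $ j \<in> {0..1}" for t i j
  proof -
    have "(\<Sum>k<Suc t. m k i * Q k $ i $ j) \<le> (\<Sum>k<Suc t. 1)"
      using m0 m1 Q0 Q1 by (intro sum_mono mult_le_one) auto
    moreover have "0 \<le> (\<Sum>k<Suc t. m k i * Q k $ i $ j)"
      using m0 Q0 by (intro sum_nonneg mult_nonneg_nonneg) auto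
    ultimately show ?thesis by (simp add: M_def divide_le_eq)
  qed
  then have "range M \<subseteq> {0..(\<chi> i j. 1)}" by (auto simp: less_eq_vec_def)
  then have "bounded (range M)"
    using bounded_subset[OF bounded_cbox] by (metis cbox_interval)
  then obtain L r where r: "strict_mono r" "(M \<circ> r) \<longlonglongrightarrow> L"
    using bounded_imp_convergent_subsequence by blast
  have lim_M: "(\<lambda>t. M (r t) $ i $ j) \<longlonglongrightarrow> L $ i $ j" for i j
    using tendsto_vec_nth[OF tendsto_vec_nth[OF r(2)]] by (simp add: o_def)
  have lim_inv: "(\<lambda>t. c / real (Suc (r t))) \<longlonglongrightarrow> 0" for c
  proof -
    have "(\<lambda>t. c / real (Suc t)) \<longlonglongrightarrow> 0"
      using tendsto_mult[OF tendsto_const[of c] LIMSEQ_inverse_real_of_nat] by (simp add: divide_inverse)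
    then show ?thesis using LIMSEQ_subseq_LIMSEQ[OF _ r(1)] by (fastforce simp: o_def)
  qed
  \<comment> \<open>Taking column sums of the limit makes the flow equation true by definition; it
    remains to identify \<open>\<nu>\<close> as the limit of the averaged masses.\<close>
  define \<nu> where "\<nu> j = (\<Sum>i\<in>UNIV. L $ i $ j)" for j
  have lim_\<mu>: "(\<lambda>t. \<mu> (r t) j) \<longlonglongrightarrow> \<nu> j" for j
  proof -
    have "(\<lambda>t. (m (Suc (r t)) j - m 0 j) / real (Suc (r t))) \<longlonglongrightarrow> 0"
    proof (rule Lim_null_comparison[OF _ lim_inv[of 1]])
      have "\<bar>m (Suc (r t)) j - m 0 j\<bar> \<le> 1" for t
        using m0[of "Suc (r t)" j] m1[of "Suc (r t)" j] m0[of 0 j] m1[of 0 j] by linarith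
      then show "\<forall>\<^sub>F t in sequentially. norm ((m (Suc (r t)) j - m 0 j) / real (Suc (r t))) \<le> 1 / real (Suc (r t))"
        by (intro always_eventually allI) (simp add: divide_right_mono)
    qed
    then have "(\<lambda>t. (\<Sum>i\<in>UNIV. M (r t) $ i $ j) - (m (Suc (r t)) j - m 0 j) / real (Suc (r t))) \<longlonglongrightarrow> \<nu> j - 0"
      unfolding \<nu>_def by (intro tendsto_diff tendsto_sum lim_M)
    then show ?thesis unfolding M_col by simp
  qed
  have \<nu>0: "0 \<le> \<nu> j" for j
    unfolding \<mu>_def by (intro LIMSEQ_le_const[OF lim_\<mu>[unfolded \<mu>_def]] exI allI impI divide_nonneg_nonneg sum_nonneg m0) simp
  have "(\<Sum>j\<in>UNIV. \<mu> t j) = 1" for t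
    unfolding \<mu>_def by (subst sum_divide_distrib[symmetric], subst sum.swap) (simp add: mass)
  then have \<nu>1: "(\<Sum>j\<in>UNIV. \<nu> j) = 1"
    using tendsto_sum[of UNIV "\<lambda>j t. \<mu> (r t) j" \<nu>, OF lim_\<mu>] by (simp add: LIMSEQ_const_iff)
  have \<nu>_crit: "\<nu> i = 0" if "i \<in> crit_nodes f v" for i
    using lim_\<mu>[of i] m_crit[OF that] by (simp add: \<mu>_def LIMSEQ_const_iff)
  obtain i where "\<nu> i \<noteq> 0" using \<nu>1 by (metis sum.neutral zero_neq_one)
  then have i: "0 < \<nu> i" using \<nu>0[of i] by simp
  have "(L *v (z - v)) $ i \<le> \<nu> i * (f z $ i - v $ i)" for i z
  proof (rule LIMSEQ_le)
    show "(\<lambda>t. (M (r t) *v (z - v)) $ i) \<longlonglongrightarrow> (L *v (z - v)) $ i"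
      unfolding matrix_vector_mult_def vec_lambda_beta
      by (intro tendsto_sum tendsto_mult lim_M tendsto_const)
    have "(\<lambda>t. \<mu> (r t) i * (f z $ i - v $ i) + 2 * B / real (Suc (r t))) \<longlonglongrightarrow> \<nu> i * (f z $ i - v $ i) + 0"
      by (intro tendsto_add tendsto_mult lim_\<mu> tendsto_const lim_inv)
    then show "(\<lambda>t. \<mu> (r t) i * (f z $ i - v $ i) + 2 * B / real (Suc (r t))) \<longlonglongrightarrow> \<nu> i * (f z $ i - v $ i)"
      by simp
  qed (use M_le in auto)
  then obtain P F where "crit_pair P F" "i \<in> F"
    using stationary_flow_critical[of \<nu> L i] \<nu>0 i \<nu>_def by metis
  then have "i \<in> crit_nodes f v" by (auto simp: crit_nodes_iff)
  then show False using \<nu>_crit i by simp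
qed

end

section \<open>Fixed points and critical classes\<close>

lemma classes_eq:
  assumes "K \<in> classes V A" "i \<in> K"
  shows "K = {j \<in> V. (i, j) \<in> A\<^sup>* \<and> (j, i) \<in> A\<^sup>*}" "i \<in> V"
proof -
  obtain k where kV: "k \<in> V"
      and "K = {(i, j). i \<in> V \<and> j \<in> V \<and> (i, j) \<in> A\<^sup>* \<and> (j, i) \<in> A\<^sup>*} `` {k}"
    using assms(1) unfolding classes_def by (rule quotientE)
  then have k: "K = {j \<in> V. (k, j) \<in> A\<^sup>* \<and> (j, k) \<in> A\<^sup>*}" by simp
  have ki: "(k, i) \<in> A\<^sup>*" "(i, k) \<in> A\<^sup>*" using assms(2) unfolding k by simp_all
  have "(k, j) \<in> A\<^sup>* \<longleftrightarrow> (i, j) \<in> A\<^sup>*" for j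
    by (rule iffI) (erule rtrancl_trans[OF ki(2)] rtrancl_trans[OF ki(1)])+
  moreover have "(j, k) \<in> A\<^sup>* \<longleftrightarrow> (j, i) \<in> A\<^sup>*" for j
    using rtrancl_trans[OF _ ki(1)] rtrancl_trans[OF _ ki(2)] by metis
  ultimately show "K = {j \<in> V. (i, j) \<in> A\<^sup>* \<and> (j, i) \<in> A\<^sup>*}" unfolding k by simp
  show "i \<in> V" using assms(2) unfolding k by simp
qed

lemma classes_subset: "K \<in> classes V A \<Longrightarrow> K \<subseteq> V"
  by (rule subsetI) (rule classes_eq(2))

lemma classes_cover:
  assumes "i \<in> V"
  obtains K where "K \<in> classes V A" "i \<in> K"
proof -
  let ?R = "{(i, j). i \<in> V \<and> j \<in> V \<and> (i, j) \<in> A\<^sup>* \<and> (j, i) \<in> A\<^sup>*}"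
  have "?R `` {i} \<in> classes V A"
    using assms unfolding classes_def by (rule quotientI)
  moreover have "i \<in> ?R `` {i}" using assms by simp
  ultimately show ?thesis using that by blast
qed

lemma classes_nonempty: "K \<in> classes V A \<Longrightarrow> K \<noteq> {}"
  unfolding classes_def by (erule quotientE) fastforce

lemma classes_unique:
  assumes "K \<in> classes V A" "K' \<in> classes V A" "i \<in> K" "i \<in> K'"
  shows "K = K'"
  by (rule trans[OF classes_eq(1)[OF assms(1,3)] classes_eq(1)[OF assms(2,4), symmetric]])

lemma finite_classes: "finite V \<Longrightarrow> finite (classes V A)"
  by (rule finite_subset[of _ "Pow V"]) (use classes_subset in auto)

lemma sum_classes_indicator:
  assumes "K0 \<in> classes V A" "i \<in> K0" "finite V"
  shows "(\<Sum>K\<in>classes V A. a K * (if i \<in> K then 1 else 0)) = (a K0 :: real)"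
proof -
  have "(\<Sum>K\<in>classes V A. a K * (if i \<in> K then 1 else 0)) = (\<Sum>K\<in>classes V A. if K = K0 then a K else 0)"
  proof (rule sum.cong)
    fix K assume K: "K \<in> classes V A"
    have "i \<in> K \<longleftrightarrow> K = K0" using classes_unique[OF K assms(1) _ assms(2)] assms(2) by metis
    then show "a K * (if i \<in> K then 1 else 0) = (if K = K0 then a K else 0)" by simp
  qed simp
  then show ?thesis using assms by (simp add: finite_classes)
qed

lemma restr_component [simp]: "restr C x $ i = (if i \<in> C then x $ i else 0)"
  by (simp add: restr_def)

lemma vec_eqI: "(\<And>i. x $ i = y $ i) \<Longrightarrow> x = y"
  by (simp add: vec_eq_iff)

context convex_monotone_fixpoint
begin

section \<open>Supersolutions on the critical nodes\<close>

lemma crit_pair_sum: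
  assumes "crit_pair P F" "i \<in> F"
  shows "(P *v x) $ i = (\<Sum>j\<in>F. P $ i $ j * x $ j)" "(\<Sum>j\<in>F. P $ i $ j) = 1"
    "\<And>j. 0 \<le> P $ i $ j"
  using assms final_class_matrix_vector subdiff_nonneg unfolding crit_pair_def stochastic_on_def by auto

lemma crit_pair_step:
  assumes "crit_pair P F" "i \<in> F"
  shows "(\<Sum>j\<in>F. P $ i $ j * (x $ j - v $ j)) \<le> f x $ i - v $ i"
  using crit_pair_sum(1)[OF assms, of "x - v"] subdiff_component[of P v x i] assms(1) fixpoint
  by (simp add: crit_pair_def)

lemma crit_pair_arc:
  assumes "crit_pair P F" "i \<in> F" "P $ i $ j \<noteq> 0"
  shows "j \<in> F"
  using assms final_class_entry_outside unfolding crit_pair_def by metis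

lemma crit_pair_subset: "crit_pair P F \<Longrightarrow> F \<subseteq> crit_nodes f v"
  using crit_nodes_iff by blast

text \<open>Every critical arc lies inside a strongly connected final class, so no arc joins two
  different critical classes.\<close>

lemma crit_arcs_sym:
  assumes "(i, j) \<in> crit_arcs f v"
  shows "(j, i) \<in> (crit_arcs f v)\<^sup>*"
proof -
  obtain P F where P: "crit_pair P F" "i \<in> F" "j \<in> F" using assms crit_arcs_iff by blast
  have "matrix_arcs P \<inter> F \<times> F \<subseteq> crit_arcs f v"
    unfolding subset_iff matrix_arcs_def using P(1) crit_arcs_iff by blast
  moreover have "(j, i) \<in> (matrix_arcs P \<inter> F \<times> F)\<^sup>*"
    using P final_class_connected unfolding crit_pair_def by blast
  ultimately show ?thesis using rtrancl_mono by blast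
qed

text \<open>A minimum principle: at a node of \<open>F\<close> minimizing \<open>x - v\<close>, the
  stochastic row of \<open>P\<close> averages \<open>x - v\<close> to at most that minimum, so all
  successors are minimizers as well.\<close>

lemma supersolution_constant:
  assumes "crit_pair P F" "f x \<le> x" "i \<in> F" "j \<in> F"
  shows "x $ i - v $ i = x $ j - v $ j"
proof -
  define u where "u = x - v"
  have f_le: "f x $ i \<le> x $ i" for i using assms(2) by (simp add: less_eq_vec_def)
  have "finite F" "F \<noteq> {}" using assms by auto
  then obtain k where k: "k \<in> F" "\<And>l. l \<in> F \<Longrightarrow> u $ k \<le> u $ l"
    using ex_min_if_finite[of "(\<lambda>l. u $ l) ` F"] by (auto simp: not_less)
  have "u $ l = u $ k" if "l \<in> F" for l
  proof -
    have "(k, l) \<in> (matrix_arcs P \<inter> F \<times> F)\<^sup>*"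
      using assms(1) k(1) that final_class_connected unfolding crit_pair_def by blast
    then show ?thesis
    proof (induction rule: rtrancl_induct)
      case (step y z)
      then have yz: "y \<in> F" "z \<in> F" "P $ y $ z \<noteq> 0" by (auto simp: matrix_arcs_def)
      have "(\<Sum>j\<in>F. P $ y $ j * u $ j) \<le> u $ k"
        using crit_pair_step[OF assms(1) yz(1), of x] f_le[of y] step.IH by (simp add: u_def)
      then have "(\<Sum>j\<in>F. P $ y $ j * (u $ j - u $ k)) \<le> 0"
        using crit_pair_sum(2)[OF assms(1) yz(1)] by (simp add: right_diff_distrib sum_subtractf flip: sum_distrib_right)
      moreover have nonneg: "0 \<le> P $ y $ j * (u $ j - u $ k)" if "j \<in> F" for j
        using k(2)[OF that] crit_pair_sum(3)[OF assms(1) yz(1)] by simp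
      ultimately have "P $ y $ z * (u $ z - u $ k) = 0"
        using yz(2) sum_nonneg[of F "\<lambda>j. P $ y $ j * (u $ j - u $ k)"]
          sum_nonneg_eq_0_iff[OF \<open>finite F\<close> nonneg] by fastforce
      then show ?case using yz(3) by simp
    qed simp
  qed
  then show ?thesis using assms(3,4) by (metis u_def vector_minus_component)
qed

text \<open>On a final class \<open>w - v\<close> is constant, and a stochastic row averages a
  constant to itself. Hence the decreasing orbit of \<open>w\<close> cannot drop on the critical
  nodes.\<close>

lemma supersolution_lower_bound:
  assumes "f w \<le> w" "\<And>j. j \<in> crit_nodes f v \<Longrightarrow> w $ j \<le> x $ j" "i \<in> crit_nodes f v"
  shows "w $ i \<le> f x $ i"
proof -
  obtain P F where P: "crit_pair P F" "i \<in> F" using assms(3) crit_nodes_iff by blast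
  have "w $ i - v $ i = (\<Sum>j\<in>F. P $ i $ j * (w $ i - v $ i))"
    using crit_pair_sum(2)[OF P] by (simp flip: sum_distrib_right)
  also have "\<dots> = (\<Sum>j\<in>F. P $ i $ j * (w $ j - v $ j))"
    using supersolution_constant[OF P(1) assms(1) P(2)] by (intro sum.cong) auto
  also have "\<dots> \<le> (\<Sum>j\<in>F. P $ i $ j * (x $ j - v $ j))"
    using assms(2) crit_pair_subset[OF P(1)] crit_pair_sum(3)[OF P]
    by (intro sum_mono mult_left_mono) auto
  also have "\<dots> \<le> f x $ i - v $ i" by (rule crit_pair_step[OF P])
  finally show ?thesis by simp
qed

lemma funpow_fixpoint: "(f ^^ k) v = v"
  by (induction k) (auto simp: fixpoint)

lemma funpow_bound: "\<bar>(f ^^ k) x $ i - v $ i\<bar> \<le> norm (x - v)"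
  using nonexpansive_funpow[of x v "norm (x - v)" k i] component_le_norm_cart[of "x - v"]
  by (simp add: funpow_fixpoint)

lemma supersolution_fixpoint:
  assumes "f w \<le> w"
  obtains z where "f z = z" "z \<le> w" "\<And>i. i \<in> crit_nodes f v \<Longrightarrow> z $ i = w $ i"
proof -
  let ?y = "\<lambda>k. (f ^^ k) w"
  have dec: "?y (Suc k) \<le> ?y k" for k
    by (induction k) (use assms mono in \<open>auto simp: mono_def\<close>)
  have "convergent (\<lambda>k. ?y k $ i)" for i
  proof (rule Bseq_monoseq_convergent)
    show "Bseq (\<lambda>k. ?y k $ i)"
    proof (rule BseqI')
      fix k show "norm (?y k $ i) \<le> norm (w - v) + \<bar>v $ i\<bar>" using funpow_bound[of k w i] by simp
    qed
    show "monoseq (\<lambda>k. ?y k $ i)"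
      using dec by (intro mono_SucI2) (simp add: less_eq_vec_def)
  qed
  then obtain l where "\<And>i. (\<lambda>k. ?y k $ i) \<longlonglongrightarrow> l i" unfolding convergent_def by metis
  then have lim: "?y \<longlonglongrightarrow> (\<chi> i. l i)" by (intro vec_tendstoI) simp
  let ?z = "\<chi> i. l i"
  have "f ?z = ?z"
    using LIMSEQ_unique[OF tendsto_map[OF lim]] LIMSEQ_Suc[OF lim] by simp
  moreover have le_w: "?y k \<le> w" for k
  proof (induction k)
    case (Suc k)
    then show ?case using dec[of k] by (rule order_trans[rotated])
  qed simp
  then have "?z $ i \<le> w $ i" for i
    using LIMSEQ_le_const2[OF tendsto_vec_nth[OF lim, of i]] by (simp add: less_eq_vec_def)
  then have "?z \<le> w" by (simp add: less_eq_vec_def)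
  moreover have "w $ i \<le> ?y k $ i" if "i \<in> crit_nodes f v" for i k
    using that by (induction k arbitrary: i) (auto intro: supersolution_lower_bound[OF assms])
  then have "w $ i \<le> ?z $ i" if "i \<in> crit_nodes f v" for i
    using LIMSEQ_le_const[OF tendsto_vec_nth[OF lim, of i]] that by blast
  ultimately show ?thesis using that[of ?z] by (auto simp: less_eq_vec_def intro: antisym)
qed

text \<open>A pair of fixed points is its own backward orbit.\<close>

lemma fixed_points_le:
  assumes "f x = x" "f y = y" "\<And>i. i \<in> crit_nodes f v \<Longrightarrow> x $ i \<le> y $ i"
  shows "x \<le> y"
  by (rule backward_comparison[of "{(x, y)}"]) (use assms in auto)

lemma fixed_points_eq:
  assumes "f x = x" "f y = y" "\<And>i. i \<in> crit_nodes f v \<Longrightarrow> x $ i = y $ i"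
  shows "x = y"
  by (rule order_antisym; rule fixed_points_le) (simp_all add: assms)

section \<open>Structure of the set of critical fixed points\<close>

lemma supersolution_crit_fixed_points:
  assumes "f w \<le> w"
  shows "restr (crit_nodes f v) w \<in> crit_fixed_points f v"
proof -
  obtain z where "f z = z" "\<And>i. i \<in> crit_nodes f v \<Longrightarrow> z $ i = w $ i"
    using supersolution_fixpoint[OF assms] by metis
  then have "f z = z" "restr (crit_nodes f v) w = restr (crit_nodes f v) z" by (auto intro: vec_eqI)
  then show ?thesis unfolding crit_fixed_points_def fixed_points_def by blast
qed

lemma restr_mono_homog_iso:
  "mono_homog_iso UNIV (crit_nodes f v) (fixed_points f) (crit_fixed_points f v) (restr (crit_nodes f v))"
proof -
  let ?C = "crit_nodes f v"
  define h where "h = inv_into (fixed_points f) (restr ?C)"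
  \<comment> \<open>This gives both the injectivity of the restriction and the monotonicity of its
    inverse.\<close>
  have le: "x \<le> y" if "x \<in> fixed_points f" "y \<in> fixed_points f" "restr ?C x \<le> restr ?C y" for x y
  proof (rule fixed_points_le)
    show "x $ i \<le> y $ i" if "i \<in> ?C" for i
      using \<open>restr ?C x \<le> restr ?C y\<close> that unfolding less_eq_vec_def by (metis restr_component)
  qed (use that in \<open>auto simp: fixed_points_def\<close>)
  have inj: "inj_on (restr ?C) (fixed_points f)"
    by (intro inj_onI) (metis le order_antisym order_refl)
  have h: "h y \<in> fixed_points f" "restr ?C (h y) = y" if "y \<in> crit_fixed_points f v" for y
    using that unfolding h_def crit_fixed_points_def by (auto intro: inv_into_into f_inv_into_f)
  have hr: "h (restr ?C x) = x" if "x \<in> fixed_points f" for x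
    unfolding h_def using inj that by (rule inv_into_f_f)
  have shift: "restr ?C (shift UNIV l x) = shift ?C l (restr ?C x)" for l x
    by (rule vec_eqI) (simp add: shift_def)
  have "mono_homog_map UNIV ?C (fixed_points f) (crit_fixed_points f v) (restr ?C)"
    unfolding mono_homog_map_def
    by (intro conjI mono_onI)
      (auto simp: coord_space_def crit_fixed_points_def less_eq_vec_def shift)
  moreover have "mono_homog_map ?C UNIV (crit_fixed_points f v) (fixed_points f) h"
    unfolding mono_homog_map_def
  proof (intro conjI mono_onI allI ballI impI)
    fix x y assume "x \<in> crit_fixed_points f v" "y \<in> crit_fixed_points f v" "x \<le> y"
    then show "h x \<le> h y" using h le by simp
  next
    fix l y assume *: "y \<in> crit_fixed_points f v" "shift ?C l y \<in> crit_fixed_points f v"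
      "shift UNIV l (h y) \<in> fixed_points f"
    then show "h (shift ?C l y) = shift UNIV l (h y)" using hr shift h by metis
  qed (use h in \<open>auto simp: coord_space_def crit_fixed_points_def\<close>)
  ultimately show ?thesis unfolding mono_homog_iso_def using hr h by blast
qed

lemma inf_subsemilattice_crit_fixed_points: "inf_subsemilattice (crit_fixed_points f v)"
  unfolding inf_subsemilattice_def
proof (intro ballI)
  let ?C = "crit_nodes f v"
  fix x y assume "x \<in> crit_fixed_points f v" "y \<in> crit_fixed_points f v"
  then obtain x' y' where *: "f x' = x'" "f y' = y'" "x = restr ?C x'" "y = restr ?C y'"
    unfolding crit_fixed_points_def fixed_points_def by blast
  have "f (inf x' y') \<le> inf x' y'"
    using monoD[OF mono, of "inf x' y'" x'] monoD[OF mono, of "inf x' y'" y'] *(1,2) by simp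
  then have "restr ?C (inf x' y') \<in> crit_fixed_points f v" by (rule supersolution_crit_fixed_points)
  also have "restr ?C (inf x' y') = inf x y" by (rule vec_eqI) (simp add: * inf_vec_def)
  finally show "inf x y \<in> crit_fixed_points f v" .
qed

lemma convex_crit_fixed_points: "convex (crit_fixed_points f v)"
proof (rule convexI)
  let ?C = "crit_nodes f v"
  fix x y and s t :: real
  assume "x \<in> crit_fixed_points f v" "y \<in> crit_fixed_points f v" and st: "0 \<le> s" "0 \<le> t" "s + t = 1"
  then obtain x' y' where *: "f x' = x'" "f y' = y'" "x = restr ?C x'" "y = restr ?C y'"
    unfolding crit_fixed_points_def fixed_points_def by blast
  let ?w = "s *\<^sub>R x' + t *\<^sub>R y'"
  have "f ?w $ i \<le> s * f x' $ i + t * f y' $ i" for i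
    using convex st unfolding convex_map_def convex_on_def by auto
  then have "f ?w \<le> ?w" by (simp add: less_eq_vec_def *)
  then have "restr ?C ?w \<in> crit_fixed_points f v" by (rule supersolution_crit_fixed_points)
  also have "restr ?C ?w = s *\<^sub>R x + t *\<^sub>R y" by (rule vec_eqI) (simp add: *)
  finally show "s *\<^sub>R x + t *\<^sub>R y \<in> crit_fixed_points f v" .
qed

lemma supersolution_constant_class:
  assumes K: "K \<in> crit_classes f v" and "f x \<le> x" "i \<in> K" "j \<in> K"
  shows "x $ i - v $ i = x $ j - v $ j"
proof -
  have "(i, j) \<in> (crit_arcs f v)\<^sup>*"
    using classes_eq(1)[OF K[unfolded crit_classes_def] assms(3)] assms(4) by simp
  then show ?thesis
  proof (induction rule: rtrancl_induct)
    case (step y z)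
    then show ?case using supersolution_constant assms(2) crit_arcs_iff by metis
  qed simp
qed

text \<open>Constancy on classes places the set in the translate by \<open>restr ?C v\<close> of the
  span of the class indicators.\<close>

lemma aff_dim_crit_fixed_points_le:
  "aff_dim (crit_fixed_points f v) \<le> int (card (crit_classes f v))"
proof -
  let ?C = "crit_nodes f v" and ?S = "crit_classes f v"
  let ?ind = "\<lambda>K. (\<chi> i. if i \<in> K then 1 else 0) :: real ^ 'n"
  have fin: "finite ?S" by (simp add: crit_classes_def finite_classes)
  have "restr ?C x \<in> (+) (restr ?C v) ` span (?ind ` ?S)" if "f x = x" for x
  proof -
    define a where "a K = (x - v) $ (SOME i. i \<in> K)" for K
    have "restr ?C x $ i = (restr ?C v + (\<Sum>K\<in>?S. a K *\<^sub>R ?ind K)) $ i" for i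
    proof (cases "i \<in> ?C")
      case True
      then obtain K0 where K0: "K0 \<in> ?S" "i \<in> K0" unfolding crit_classes_def by (rule classes_cover)
      have k0: "(SOME i. i \<in> K0) \<in> K0" using K0(2) by (rule someI)
      have "a K0 = x $ i - v $ i"
        unfolding a_def vector_minus_component
        by (rule supersolution_constant_class[OF K0(1) _ k0 K0(2)]) (simp add: that)
      moreover have "(\<Sum>K\<in>?S. a K * (if i \<in> K then 1 else 0)) = a K0"
        using K0 unfolding crit_classes_def by (intro sum_classes_indicator) auto
      ultimately show ?thesis using True by simp
    next
      case False
      then have "i \<notin> K" if "K \<in> ?S" for K using that classes_subset unfolding crit_classes_def by blast
      then show ?thesis using False by simp
    qed
    then have "restr ?C x = restr ?C v + (\<Sum>K\<in>?S. a K *\<^sub>R ?ind K)" by (rule vec_eqI)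
    moreover have "(\<Sum>K\<in>?S. a K *\<^sub>R ?ind K) \<in> span (?ind ` ?S)"
      by (intro span_sum span_scale span_base imageI)
    ultimately show ?thesis by blast
  qed
  then have "crit_fixed_points f v \<subseteq> (+) (restr ?C v) ` span (?ind ` ?S)"
    unfolding crit_fixed_points_def fixed_points_def by blast
  then have "aff_dim (crit_fixed_points f v) \<le> aff_dim ((+) (restr ?C v) ` span (?ind ` ?S))"
    by (rule aff_dim_subset)
  also have "\<dots> = int (dim (?ind ` ?S))"
    by (simp add: aff_dim_translation_eq aff_dim_subspace)
  also have "\<dots> \<le> int (card (?ind ` ?S))" using fin by (simp add: dim_le_card')
  also have "\<dots> \<le> int (card ?S)" using fin by (simp add: card_image_le)
  finally show ?thesis .
qed

end

section \<open>Piecewise affine maps\<close>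

lemma interior_Union_closed_empty:
  assumes "finite S" "\<And>K. K \<in> S \<Longrightarrow> closed K" "\<And>K. K \<in> S \<Longrightarrow> interior K = {}"
  shows "interior (\<Union>S) = {}"
  using assms
proof (induction S)
  case (insert K S)
  then have "closed K" "interior (\<Union>S) = {}" by simp_all
  then have "interior (K \<union> \<Union>S) = interior K" by (rule interior_closed_Un_empty_interior)
  then show ?case using insert.prems(2)[of K] by simp
qed simp

text \<open>
  The pieces with nonempty interior already cover the space, and on such a piece the affine map is
  a global minorant by convexity.
\<close>

lemma convex_piecewise_affine_max:
  fixes f :: "real ^ 'n::finite \<Rightarrow> real ^ 'm::finite"
  assumes "convex_map f" "piecewise_affine f"
  obtains T where "finite T" "\<And>A b z i. (A, b) \<in> T \<Longrightarrow> (A *v z + b) $ i \<le> f z $ i"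
    "\<And>x. \<exists>(A, b)\<in>T. f x = A *v x + b"
proof -
  obtain S where S: "finite S" "\<Union>S = UNIV" and
      pieces: "\<forall>K\<in>S. polyhedron K \<and> (\<exists>A b. \<forall>x\<in>K. f x = A *v x + b)"
    using assms(2) unfolding piecewise_affine_def by (elim exE conjE)
  have closed: "closed K" if "K \<in> S" for K using pieces that by (simp add: polyhedron_imp_closed)
  have "\<forall>K\<in>S. \<exists>p. \<forall>x\<in>K. f x = fst p *v x + snd p"
    using pieces by (metis fst_conv snd_conv)
  then obtain p where p: "\<And>K x. K \<in> S \<Longrightarrow> x \<in> K \<Longrightarrow> f x = fst (p K) *v x + snd (p K)"
    by metis
  define S' where "S' = {K \<in> S. interior K \<noteq> {}}"
  \<comment> \<open>The points missed by \<open>S'\<close> form an open set inside a finite union of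
    closed sets with empty interior, hence there are none.\<close>
  have "closed (\<Union>S')" using S(1) closed by (intro closed_Union) (auto simp: S'_def)
  moreover have "- \<Union>S' \<subseteq> \<Union>(S - S')" using S(2) by auto
  ultimately have "- \<Union>S' \<subseteq> interior (\<Union>(S - S'))"
    by (intro interior_maximal) (auto simp: open_Compl)
  moreover have "interior (\<Union>(S - S')) = {}"
    using S(1) closed by (intro interior_Union_closed_empty) (auto simp: S'_def)
  ultimately have cover: "\<Union>S' = UNIV" by blast
  have minorant: "(fst (p K) *v z + snd (p K)) $ i \<le> f z $ i" if K: "K \<in> S'" for K z i
  proof -
    obtain x e where e: "0 < e" "ball x e \<subseteq> K"
      using K unfolding S'_def by (auto simp: mem_interior)
    \<comment> \<open>Small enough for \<open>x + t *\<^sub>R (z - x)\<close> to stay in the ball;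
      the \<open>+ 1\<close> covers \<open>z = x\<close>. Convexity on the segment from
      \<open>x\<close> to \<open>z\<close>, with \<open>f\<close> known at two points of
      \<open>K\<close>, then bounds \<open>f z\<close> from below.\<close>
    define t where "t = min 1 (e / (2 * (norm (z - x) + 1)))"
    have t: "0 < t" "t \<le> 1" using e(1) by (auto simp: t_def add_nonneg_pos)
    have "t * norm (z - x) \<le> e / (2 * (norm (z - x) + 1)) * norm (z - x)"
      by (intro mult_right_mono) (auto simp: t_def)
    also have "\<dots> = e * (norm (z - x) / (2 * (norm (z - x) + 1)))" by simp
    also have "\<dots> < e * 1"
    proof (rule mult_strict_left_mono[OF _ e(1)])
      have "0 < 2 * (norm (z - x) + 1)" by (simp add: add_nonneg_pos)
      then show "norm (z - x) / (2 * (norm (z - x) + 1)) < 1"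
        using norm_ge_zero[of "z - x"] by (simp only: pos_divide_less_eq distrib_left)
    qed
    finally have "t * norm (z - x) < e" by simp
    then have y: "x + t *\<^sub>R (z - x) \<in> K" using e(2) t(1) by (auto simp: dist_norm)
    have x: "x \<in> K" using e by auto
    have KS: "K \<in> S" using K by (simp add: S'_def)
    let ?A = "fst (p K)" and ?b = "snd (p K)"
    have "f (x + t *\<^sub>R (z - x)) $ i \<le> (1 - t) * f x $ i + t * f z $ i"
    proof -
      have "x + t *\<^sub>R (z - x) = (1 - t) *\<^sub>R x + t *\<^sub>R z" by (simp add: algebra_simps)
      then show ?thesis
        using assms(1) t unfolding convex_map_def convex_on_def by simp
    qed
    then have "t * (?A *v z + ?b) $ i \<le> t * f z $ i"
      unfolding p[OF KS y] p[OF KS x]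
      by (simp add: matrix_vector_right_distrib matrix_vector_mult_scaleR matrix_vector_mult_diff_distrib algebra_simps)
    then show ?thesis using t(1) by simp
  qed
  show ?thesis
  proof (rule that[of "p ` S'"])
    show "finite (p ` S')" using S(1) by (simp add: S'_def)
    show "(A *v z + b) $ i \<le> f z $ i" if "(A, b) \<in> p ` S'" for A b z i
      using that minorant by (metis fst_conv imageE snd_conv)
    show "\<exists>(A, b)\<in>p ` S'. f x = A *v x + b" for x
    proof -
      obtain K where K: "K \<in> S'" "x \<in> K" using cover by blast
      then have "f x = fst (p K) *v x + snd (p K)" using p by (simp add: S'_def)
      then show ?thesis using K(1) by (intro bexI[of _ "p K"]) (auto simp: case_prod_beta)
    qed
  qed
qed

lemma small_perturbation:
  fixes p q :: "'a \<Rightarrow> real"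
  assumes "finite X" "\<And>x. x \<in> X \<Longrightarrow> p x < 0"
  obtains d where "0 < d" "\<And>x. x \<in> X \<Longrightarrow> p x + d * q x \<le> 0"
proof -
  have "\<forall>\<^sub>F d in at_right 0. p x + d * q x \<le> 0" if "x \<in> X" for x
  proof -
    have "((\<lambda>d. p x + d * q x) \<longlongrightarrow> p x + 0 * q x) (at_right 0)"
      by (intro tendsto_intros)
    then have "\<forall>\<^sub>F d in at_right 0. p x + d * q x < 0"
      using assms(2)[OF that] by (intro order_tendstoD(2)) auto
    then show ?thesis by (rule eventually_mono) simp
  qed
  then have "\<forall>\<^sub>F d in at_right 0. \<forall>x\<in>X. p x + d * q x \<le> 0"
    using assms(1) by (intro eventually_ball_finite) auto
  then have "\<forall>\<^sub>F d in at_right 0. 0 < d \<and> (\<forall>x\<in>X. p x + d * q x \<le> 0)"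
    using eventually_at_right_less by (rule eventually_conj[rotated])
  then show ?thesis using that eventually_happens trivial_limit_at_right_real by blast
qed

context convex_monotone_fixpoint
begin

section \<open>Tight rows at the fixed point, and the lower bound on the dimension\<close>

lemma subgradient_row:
  assumes "\<And>z. (\<Sum>j\<in>UNIV. a $ j * (z $ j - v $ j)) \<le> f z $ i - v $ i"
  shows "0 \<le> a $ j" "(\<Sum>j\<in>UNIV. a $ j) \<le> 1"
proof -
  obtain P0 where P0: "P0 \<in> subdiff f v" using subdiff_nonempty by blast
  \<comment> \<open>Only row \<open>i\<close> is prescribed; the other rows come from an arbitrary
    subgradient, so that the bounds for matrices apply.\<close>
  let ?P = "\<chi> k. if k = i then a else P0 $ k"
  have "?P \<in> subdiff f v"
  proof (rule subdiff_componentI)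
    show "(?P *v (z - v)) $ k \<le> f z $ k - f v $ k" for k z
      using assms[of z] subdiff_component[OF P0, of z k]
      by (cases "k = i") (auto simp: matrix_vector_mult_def fixpoint)
  qed
  from subdiff_nonneg[OF this, of i j] subdiff_row_le[OF this, of i]
  show "0 \<le> a $ j" "(\<Sum>j\<in>UNIV. a $ j) \<le> 1" by simp_all
qed

text \<open>A pair \<open>(i, a)\<close> is a subgradient row \<open>a\<close> of coordinate
  \<open>i\<close>. Farkas' lemma gives either a direction relaxing \<open>(i0, a0)\<close> and
  violating no other row, or multipliers with vanishing combination of the vectors
  \<open>axis i 1 - a\<close>. That equation says precisely that the multipliers form a stationary
  flow, so \<open>(i0, a0)\<close> contributes to a critical row.\<close>

lemma strict_or_critical_row:
  fixes I :: "('n \<times> (real ^ 'n)) set"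
  assumes fin: "finite I"
    and sub: "\<And>i a z. (i, a) \<in> I \<Longrightarrow> (\<Sum>j\<in>UNIV. a $ j * (z $ j - v $ j)) \<le> f z $ i - v $ i"
    and k0: "(i0, a0) \<in> I"
  shows "(\<exists>u. (\<forall>(i, a)\<in>I. a \<bullet> u \<le> u $ i) \<and> a0 \<bullet> u < u $ i0) \<or>
    (\<exists>P F. crit_pair P F \<and> i0 \<in> F \<and> (\<forall>j. j \<notin> F \<longrightarrow> a0 $ j = 0) \<and> (\<Sum>j\<in>F. a0 $ j) = 1)"
proof -
  define g :: "'n \<times> (real ^ 'n) \<Rightarrow> real ^ 'n" where "g k = axis (fst k) 1 - snd k" for k
  have g: "g k \<bullet> u = u $ fst k - snd k \<bullet> u" for k u
    by (simp add: g_def inner_diff_left inner_axis')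
  have nonneg: "0 \<le> snd k $ j" and row: "(\<Sum>j\<in>UNIV. snd k $ j) \<le> 1" if "k \<in> I" for k j
    using subgradient_row[of "snd k" "fst k"] sub[of "fst k" "snd k"] that by auto
  consider u where "\<forall>k\<in>I. 0 \<le> g k \<bullet> u" "0 < g (i0, a0) \<bullet> u"
    | c :: "'n \<times> (real ^ 'n) \<Rightarrow> real" where "\<forall>k. 0 \<le> c k" "0 < c (i0, a0)" "(\<Sum>k\<in>I. c k *\<^sub>R g k) = 0"
    using Farkas_strict[OF fin k0, of g] by blast
  then show ?thesis
  proof cases
    case 1
    then show ?thesis unfolding g by (intro disjI1 exI[of _ u]) auto
  next
    case 2
    define \<mu> where "\<mu> i = (\<Sum>k\<in>I. if fst k = i then c k else 0)" for i
    define M :: "real ^ 'n ^ 'n" where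
      "M = (\<chi> i j. \<Sum>k\<in>I. (if fst k = i then c k else 0) * snd k $ j)"
    have \<mu>0: "0 \<le> \<mu> i" for i using 2(1) by (auto simp: \<mu>_def intro!: sum_nonneg)
    have le: "(M *v (z - v)) $ i \<le> \<mu> i * (f z $ i - v $ i)" for i z
    proof -
      have "(M *v (z - v)) $ i =
          (\<Sum>k\<in>I. (if fst k = i then c k else 0) * (\<Sum>j\<in>UNIV. snd k $ j * (z $ j - v $ j)))"
        unfolding M_def matrix_vector_mult_def vec_lambda_beta vector_minus_component
          sum_distrib_left sum_distrib_right mult.assoc
        by (rule sum.swap)
      also have "\<dots> \<le> (\<Sum>k\<in>I. (if fst k = i then c k else 0) * (f z $ i - v $ i))"
      proof (rule sum_mono)
        fix k assume "k \<in> I"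
        then show "(if fst k = i then c k else 0) * (\<Sum>j\<in>UNIV. snd k $ j * (z $ j - v $ j))
            \<le> (if fst k = i then c k else 0) * (f z $ i - v $ i)"
          using sub[of "fst k" "snd k" z] 2(1)[rule_format, of k]
          by (cases k) (auto intro!: mult_left_mono)
      qed
      finally show ?thesis by (simp add: \<mu>_def sum_distrib_right)
    qed
    have flow: "(\<Sum>i\<in>UNIV. M $ i $ j) = \<mu> j" for j
    proof -
      have "(\<Sum>k\<in>I. c k *\<^sub>R g k) $ j = 0" using 2(3) by simp
      then have "(\<Sum>k\<in>I. (if fst k = j then c k else 0) - c k * snd k $ j) = 0"
        by (simp add: g_def axis_def algebra_simps if_distrib[of "\<lambda>x. c _ * x"] eq_commute[of j] cong: if_cong)
      then have "\<mu> j = (\<Sum>k\<in>I. c k * snd k $ j)" by (simp add: \<mu>_def sum_subtractf)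
      also have "\<dots> = (\<Sum>i\<in>UNIV. M $ i $ j)"
        unfolding M_def vec_lambda_beta
        by (subst sum.swap) (simp flip: sum_distrib_right)
      finally show ?thesis by simp
    qed
    have c_le: "c (i0, a0) \<le> \<mu> i0"
      unfolding \<mu>_def using member_le_sum[OF k0, of "\<lambda>k. if fst k = i0 then c k else 0"] 2(1) fin by auto
    then have \<mu>_pos: "0 < \<mu> i0" using 2(2) by simp
    obtain P F where P: "crit_pair P F" "i0 \<in> F" "\<And>j. M $ i0 $ j = \<mu> i0 * P $ i0 $ j"
      using stationary_flow_critical[OF \<mu>0 le flow \<mu>_pos] by blast
    \<comment> \<open>\<open>a0\<close> enters row \<open>i0\<close> of \<open>M\<close> with
      positive weight among nonnegative terms, so it vanishes wherever that row does. The same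
      argument applied to the row deficits gives the sum 1.\<close>
    have a0_out: "a0 $ j = 0" if "j \<notin> F" for j
    proof -
      have "M $ i0 $ j = 0" using P(3)[of j] crit_pair_arc[OF P(1,2), of j] that by auto
      then have "(\<Sum>k\<in>I. (if fst k = i0 then c k else 0) * snd k $ j) = 0" by (simp add: M_def)
      then have "\<forall>k\<in>I. (if fst k = i0 then c k else 0) * snd k $ j = 0"
        using fin 2(1) nonneg by (subst (asm) sum_nonneg_eq_0_iff) auto
      then show ?thesis using k0 2(2) by force
    qed
    have "(\<Sum>j\<in>UNIV. a0 $ j) = 1"
    proof -
      have "\<mu> i0 * (\<Sum>j\<in>UNIV. P $ i0 $ j) = (\<Sum>j\<in>UNIV. M $ i0 $ j)"
        by (simp add: P(3) sum_distrib_left)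
      also have "\<dots> = (\<Sum>k\<in>I. (if fst k = i0 then c k else 0) * (\<Sum>j\<in>UNIV. snd k $ j))"
        unfolding M_def vec_lambda_beta by (subst sum.swap) (simp add: sum_distrib_left)
      finally have "\<mu> i0 * (\<Sum>j\<in>UNIV. P $ i0 $ j) =
        (\<Sum>k\<in>I. (if fst k = i0 then c k else 0) * (\<Sum>j\<in>UNIV. snd k $ j))" .
      moreover have "(\<Sum>j\<in>UNIV. P $ i0 $ j) = 1"
      proof -
        have "(\<Sum>j\<in>UNIV. P $ i0 $ j) = (\<Sum>j\<in>F. P $ i0 $ j)"
          using crit_pair_arc[OF P(1,2)] by (intro sum.mono_neutral_right) auto
        then show ?thesis using crit_pair_sum(2)[OF P(1,2)] by simp
      qed
      ultimately have "(\<Sum>k\<in>I. (if fst k = i0 then c k else 0) * (1 - (\<Sum>j\<in>UNIV. snd k $ j))) = 0"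
        by (simp add: right_diff_distrib sum_subtractf \<mu>_def)
      then have "\<forall>k\<in>I. (if fst k = i0 then c k else 0) * (1 - (\<Sum>j\<in>UNIV. snd k $ j)) = 0"
        using fin 2(1) row by (subst (asm) sum_nonneg_eq_0_iff) auto
      then show ?thesis using k0 2(2) by force
    qed
    also have "(\<Sum>j\<in>UNIV. a0 $ j) = (\<Sum>j\<in>F. a0 $ j)"
      using a0_out by (intro sum.mono_neutral_right) auto
    finally show ?thesis using P(1,2) a0_out by blast
  qed
qed

lemma crit_pair_class:
  assumes "crit_pair P F" "K \<in> crit_classes f v" "i \<in> F" "i \<in> K"
  shows "F \<subseteq> K"
proof
  fix j assume j: "j \<in> F"
  have "matrix_arcs P \<inter> F \<times> F \<subseteq> crit_arcs f v"
    unfolding subset_iff matrix_arcs_def using assms(1) crit_arcs_iff by blast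
  then have "(matrix_arcs P \<inter> F \<times> F)\<^sup>* \<subseteq> (crit_arcs f v)\<^sup>*" by (rule rtrancl_mono)
  then have "(i, j) \<in> (crit_arcs f v)\<^sup>*" "(j, i) \<in> (crit_arcs f v)\<^sup>*"
    using final_class_connected assms(1,3) j unfolding crit_pair_def by blast+
  moreover have "j \<in> crit_nodes f v" using crit_pair_subset[OF assms(1)] j by blast
  ultimately show "j \<in> K"
    unfolding classes_eq(1)[OF assms(2)[unfolded crit_classes_def] assms(4)] by simp
qed

text \<open>Provides a base point and one independent direction per class, with a common step
  length, as the lower bound on the dimension requires.\<close>

lemma piecewise_affine_supersolutions:
  assumes "piecewise_affine f"
  obtains w c where "0 < c" "f w \<le> w"
    "\<And>K. K \<in> crit_classes f v \<Longrightarrow>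
      f (w + c *\<^sub>R (\<chi> i. if i \<in> K then 1 else 0)) \<le> w + c *\<^sub>R (\<chi> i. if i \<in> K then 1 else 0)"
proof -
  let ?ind = "\<lambda>K. (\<chi> i. if i \<in> K then 1 else 0) :: real ^ 'n"
  obtain T where T: "finite T" "\<And>A b z i. (A, b) \<in> T \<Longrightarrow> (A *v z + b) $ i \<le> f z $ i"
    "\<And>x. \<exists>(A, b)\<in>T. f x = A *v x + b"
    using convex_piecewise_affine_max[OF convex assms] by metis
  \<comment> \<open>An index \<open>(i, A, b)\<close> is coordinate \<open>i\<close> of an affine
    minorant; \<open>val\<close> is its value, \<open>rw\<close> its gradient.\<close>
  define E where "E = (UNIV :: 'n set) \<times> T"
  have finE: "finite E" using T(1) by (simp add: E_def)
  define val where "val k x = (fst (snd k) *v x + snd (snd k)) $ fst k" for k :: "'n \<times> (real ^ 'n ^ 'n) \<times> (real ^ 'n)" and x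
  define rw where "rw k = fst (snd k) $ fst k" for k :: "'n \<times> (real ^ 'n ^ 'n) \<times> (real ^ 'n)"
  have val_add: "val k (x + y) = val k x + rw k \<bullet> y" for k x y
    by (simp add: val_def rw_def matrix_vector_right_distrib matrix_vector_mul_component)
  have val_le: "val k z \<le> f z $ fst k" if "k \<in> E" for k z
    using that T(2) by (auto simp: E_def val_def)
  have superI: "f x \<le> x" if "\<And>k. k \<in> E \<Longrightarrow> val k x \<le> x $ fst k" for x
    unfolding less_eq_vec_def
  proof
    fix i
    obtain A b where "(A, b) \<in> T" "f x = A *v x + b" using T(3)[of x] by blast
    then show "f x $ i \<le> x $ i" using that[of "(i, A, b)"] by (simp add: E_def val_def)
  qed
  define act where "act = {k \<in> E. val k v = v $ fst k}"
  define I where "I = (\<lambda>k. (fst k, rw k)) ` act"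
  have fin: "finite I" using finE by (simp add: I_def act_def)
  have sub: "(\<Sum>j\<in>UNIV. a $ j * (z $ j - v $ j)) \<le> f z $ i - v $ i" if "(i, a) \<in> I" for i a z
  proof -
    obtain k where k: "k \<in> E" "val k v = v $ i" "i = fst k" "a = rw k"
      using \<open>(i, a) \<in> I\<close> unfolding I_def act_def by auto
    have "val k z = v $ i + a \<bullet> (z - v)" using val_add[of k v "z - v"] k by simp
    then show ?thesis using val_le[OF k(1), of z] k(3) by (simp add: inner_vec_def)
  qed
  define crit where "crit = (\<lambda>(i, a).
      \<exists>P F. crit_pair P F \<and> i \<in> F \<and> (\<forall>j. j \<notin> F \<longrightarrow> a $ j = 0) \<and> (\<Sum>j\<in>F. a $ j) = (1::real))"
  define N where "N = {k \<in> I. \<not> crit k}"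
  have "\<exists>u. (\<forall>(i, a)\<in>I. a \<bullet> u \<le> u $ i) \<and> snd k \<bullet> u < u $ fst k" if "k \<in> N" for k
    using strict_or_critical_row[OF fin sub, of "fst k" "snd k"] that
    unfolding N_def crit_def by (auto simp: case_prod_beta)
  then obtain U where U: "\<And>k i a. k \<in> N \<Longrightarrow> (i, a) \<in> I \<Longrightarrow> a \<bullet> U k \<le> U k $ i"
      "\<And>k. k \<in> N \<Longrightarrow> snd k \<bullet> U k < U k $ fst k"
    by (metis (no_types, lifting) case_prodD)
  \<comment> \<open>Each summand is weakly admissible in all rows and strict in one, so the sum is
    strict in every noncritical row at once.\<close>
  define u where "u = (\<Sum>k\<in>N. U k)"
  have u: "a \<bullet> u \<le> u $ i" if "(i, a) \<in> I" for i a
    using U(1)[OF _ that] by (simp add: u_def inner_sum_right sum_mono)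
  have u_strict: "snd k \<bullet> u < u $ fst k" if "k \<in> N" for k
  proof -
    have "finite N" using fin by (simp add: N_def)
    moreover have "snd k \<bullet> U l \<le> U l $ fst k" if "l \<in> N" for l
      using U(1)[OF that, of "fst k" "snd k"] \<open>k \<in> N\<close> by (simp add: N_def)
    ultimately have "(\<Sum>l\<in>N. snd k \<bullet> U l) < (\<Sum>l\<in>N. U l $ fst k)"
      using that U(2) by (intro sum_strict_mono_ex1 bexI[of _ k] ballI)
    then show ?thesis by (simp add: u_def inner_sum_right)
  qed
  \<comment> \<open>A critical row averages over some \<open>F\<close> that lies inside
    \<open>K\<close> or is disjoint from it, so adding the indicator of \<open>K\<close> preserves
    the inequality in that row.\<close>
  have crit_ind: "a \<bullet> ?ind K = ?ind K $ i" if "crit (i, a)" "K \<in> crit_classes f v" for i a K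
  proof -
    obtain P F where F: "crit_pair P F" "i \<in> F" "\<And>j. j \<notin> F \<Longrightarrow> a $ j = 0" "(\<Sum>j\<in>F. a $ j) = 1"
      using \<open>crit (i, a)\<close> unfolding crit_def by blast
    have FK: "j \<in> K \<longleftrightarrow> i \<in> K" if "j \<in> F" for j
      using crit_pair_class[OF F(1) \<open>K \<in> crit_classes f v\<close>] F(2) that by blast
    have "a \<bullet> ?ind K = (\<Sum>j\<in>F. a $ j * ?ind K $ j)"
      unfolding inner_vec_def inner_real_def using F(3) by (intro sum.mono_neutral_right) auto
    also have "\<dots> = (\<Sum>j\<in>F. a $ j * ?ind K $ i)"
      using FK by (intro sum.cong) simp_all
    finally show ?thesis using F(4) by (simp flip: sum_distrib_right)
  qed
  let ?S = "crit_classes f v"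
  have finS: "finite ?S" by (simp add: crit_classes_def finite_classes)
  \<comment> \<open>The slack of the noncritical active rows along \<open>u\<close> absorbs
    \<open>d\<close> times any class indicator.\<close>
  obtain d where d: "0 < d" "\<And>k K. k \<in> N \<Longrightarrow> K \<in> ?S \<Longrightarrow>
      (snd k \<bullet> u - u $ fst k) + d * (snd k \<bullet> ?ind K - ?ind K $ fst k) \<le> 0"
  proof -
    obtain d where "0 < d" "\<And>x. x \<in> N \<times> ?S \<Longrightarrow> (snd (fst x) \<bullet> u - u $ fst (fst x))
        + d * (snd (fst x) \<bullet> ?ind (snd x) - ?ind (snd x) $ fst (fst x)) \<le> 0"
      by (rule small_perturbation[of "N \<times> ?S" "\<lambda>x. snd (fst x) \<bullet> u - u $ fst (fst x)"
            "\<lambda>x. snd (fst x) \<bullet> ?ind (snd x) - ?ind (snd x) $ fst (fst x)"])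
        (use fin finS u_strict in \<open>auto simp: N_def\<close>)
    then show ?thesis using that[of d] by force
  qed
  define X where "X = insert u ((\<lambda>K. u + d *\<^sub>R ?ind K) ` ?S)"
  have finX: "finite X" using finS by (simp add: X_def)
  have X_act: "a \<bullet> x \<le> x $ i" if "x \<in> X" "(i, a) \<in> I" for x i a
  proof -
    have "a \<bullet> (u + d *\<^sub>R ?ind K) \<le> (u + d *\<^sub>R ?ind K) $ i" if K: "K \<in> ?S" for K
    proof (cases "crit (i, a)")
      case True
      have "a \<bullet> (u + d *\<^sub>R ?ind K) = a \<bullet> u + d * (a \<bullet> ?ind K)" by (simp add: inner_add_right)
      also have "\<dots> = a \<bullet> u + d * ?ind K $ i" using crit_ind[OF True K] by simp
      also have "\<dots> \<le> (u + d *\<^sub>R ?ind K) $ i" using u[OF \<open>(i, a) \<in> I\<close>] by simp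
      finally show ?thesis .
    next
      case False
      then have "(i, a) \<in> N" using \<open>(i, a) \<in> I\<close> by (simp add: N_def)
      from d(2)[OF this K] have "a \<bullet> u + d * (a \<bullet> ?ind K) \<le> u $ i + d * ?ind K $ i"
        by (simp only: fst_conv snd_conv right_diff_distrib)
      then show ?thesis by (simp add: inner_add_right)
    qed
    then show ?thesis using that u unfolding X_def by blast
  qed
  \<comment> \<open>Rows inactive at \<open>v\<close> have slack at \<open>v\<close> itself, which
    absorbs a step \<open>e\<close> in any direction of \<open>X\<close>; whence
    \<open>c = e * d\<close>.\<close>
  obtain e where e: "0 < e" "\<And>k x. k \<in> E - act \<Longrightarrow> x \<in> X \<Longrightarrow>
      (val k v - v $ fst k) + e * (rw k \<bullet> x - x $ fst k) \<le> 0"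
  proof -
    have "val k v < v $ fst k" if "k \<in> E - act" for k
      using val_le[of k v] that by (auto simp: act_def fixpoint less_le)
    then have neg: "val (fst y) v - v $ fst (fst y) < 0" if "y \<in> (E - act) \<times> X" for y
      using that by auto
    obtain e where e: "0 < e" "\<And>y. y \<in> (E - act) \<times> X \<Longrightarrow>
        (val (fst y) v - v $ fst (fst y)) + e * (rw (fst y) \<bullet> snd y - snd y $ fst (fst y)) \<le> 0"
      using small_perturbation[of "(E - act) \<times> X" "\<lambda>y. val (fst y) v - v $ fst (fst y)"
          "\<lambda>y. rw (fst y) \<bullet> snd y - snd y $ fst (fst y)"] finE finX neg
      by (metis finite_Diff finite_cartesian_product)
    show ?thesis
    proof (rule that[OF e(1)])
      fix k x assume "k \<in> E - act" "x \<in> X"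
      then show "(val k v - v $ fst k) + e * (rw k \<bullet> x - x $ fst k) \<le> 0" using e(2)[of "(k, x)"] by simp
    qed
  qed
  have super: "f (v + e *\<^sub>R x) \<le> v + e *\<^sub>R x" if x: "x \<in> X" for x
  proof (rule superI)
    fix k assume k: "k \<in> E"
    have "val k v + e * (rw k \<bullet> x) \<le> v $ fst k + e * x $ fst k"
    proof (cases "k \<in> act")
      case True
      then have "rw k \<bullet> x \<le> x $ fst k" using X_act[OF x] unfolding I_def by blast
      then have "e * (rw k \<bullet> x) \<le> e * x $ fst k" using e(1) by (simp add: mult_left_mono)
      then show ?thesis using True by (simp add: act_def)
    next
      case False
      then show ?thesis using e(2)[of k x] k x by (simp add: algebra_simps)
    qed
    then show "val k (v + e *\<^sub>R x) \<le> (v + e *\<^sub>R x) $ fst k" by (simp add: val_add)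
  qed
  show ?thesis
  proof (rule that[of "e * d" "v + e *\<^sub>R u"])
    show "0 < e * d" using e(1) d(1) by simp
    show "f (v + e *\<^sub>R u) \<le> v + e *\<^sub>R u" using super by (simp add: X_def)
    fix K assume "K \<in> ?S"
    then have "u + d *\<^sub>R ?ind K \<in> X" unfolding X_def by blast
    then have "f (v + e *\<^sub>R (u + d *\<^sub>R ?ind K)) \<le> v + e *\<^sub>R (u + d *\<^sub>R ?ind K)" by (rule super)
    then show "f (v + e *\<^sub>R u + (e * d) *\<^sub>R ?ind K) \<le> v + e *\<^sub>R u + (e * d) *\<^sub>R ?ind K"
      by (simp add: scaleR_add_right add.assoc)
  qed
qed

lemma aff_dim_crit_fixed_points_ge:
  assumes "piecewise_affine f"
  shows "int (card (crit_classes f v)) \<le> aff_dim (crit_fixed_points f v)"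
proof -
  let ?C = "crit_nodes f v" and ?S = "crit_classes f v"
  let ?ind = "\<lambda>K. (\<chi> i. if i \<in> K then 1 else 0) :: real ^ 'n"
  obtain w c where c: "0 < c" "f w \<le> w"
      "\<And>K. K \<in> ?S \<Longrightarrow> f (w + c *\<^sub>R ?ind K) \<le> w + c *\<^sub>R ?ind K"
    using piecewise_affine_supersolutions[OF assms] by metis
  define B where "B = (\<lambda>K. c *\<^sub>R ?ind K) ` ?S"
  define z where "z = restr ?C w"
  have z: "z \<in> crit_fixed_points f v"
    unfolding z_def using supersolution_crit_fixed_points[OF c(2)] .
  have zB: "z + b \<in> crit_fixed_points f v" if "b \<in> B" for b
  proof -
    obtain K where K: "K \<in> ?S" "b = c *\<^sub>R ?ind K" using \<open>b \<in> B\<close> by (auto simp: B_def)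
    have "K \<subseteq> ?C" using K(1) classes_subset unfolding crit_classes_def by blast
    then have "restr ?C (w + c *\<^sub>R ?ind K) = z + b"
      by (intro vec_eqI) (auto simp: z_def K(2))
    then show ?thesis using supersolution_crit_fixed_points[OF c(3)[OF K(1)]] by simp
  qed
  have "inj_on (\<lambda>K. c *\<^sub>R ?ind K) ?S"
  proof (rule inj_onI)
    fix K L assume "c *\<^sub>R ?ind K = c *\<^sub>R ?ind L"
    then have "?ind K $ i = ?ind L $ i" for i using c(1) by simp
    then show "K = L" by (auto simp: set_eq_iff split: if_splits) (metis zero_neq_one)+
  qed
  then have card: "card B = card ?S" unfolding B_def by (rule card_image)
  have "independent B"
  \<comment> \<open>Distinct classes are disjoint, so their indicators are orthogonal.\<close>
  proof (rule pairwise_orthogonal_independent)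
    show "pairwise orthogonal B"
      unfolding B_def pairwise_image
    proof (rule pairwiseI, intro impI)
      fix K L assume KL: "K \<in> ?S" "L \<in> ?S" "K \<noteq> L"
      then have "\<not> (i \<in> K \<and> i \<in> L)" for i
        using classes_unique unfolding crit_classes_def by metis
      then have "?ind K \<bullet> ?ind L = 0" by (auto simp: inner_vec_def intro!: sum.neutral)
      then show "orthogonal (c *\<^sub>R ?ind K) (c *\<^sub>R ?ind L)" by (simp add: orthogonal_def)
    qed
    show "0 \<notin> B"
    proof
      assume "0 \<in> B"
      then obtain K where K: "K \<in> ?S" "?ind K = 0" using c(1) unfolding B_def by auto
      obtain i where "i \<in> K" using K(1) classes_nonempty unfolding crit_classes_def by blast
      then have "?ind K $ i = 1" by simp
      then show False using K(2) by simp
    qed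
  qed
  then have "int (card ?S) = int (dim B)" using dim_eq_card_independent card by metis
  also have "\<dots> = int (dim (insert 0 B))" by (simp add: dim_insert span_zero)
  also have "\<dots> = aff_dim (insert 0 B)" by (rule aff_dim_zero[symmetric]) (simp add: hull_inc)
  also have "\<dots> = aff_dim ((+) z ` insert 0 B)" by (simp only: aff_dim_translation_eq)
  also have "\<dots> \<le> aff_dim (crit_fixed_points f v)"
    using z zB by (intro aff_dim_subset) auto
  finally show ?thesis .
qed

end

section \<open>Limit sets and convergence\<close>

context convex_monotone_fixpoint
begin

definition omega_limit :: "real ^ 'n \<Rightarrow> (real ^ 'n) set" where
  "omega_limit x = (\<Inter>N. closure ((\<lambda>k. (f ^^ k) x) ` {N..}))"

text \<open>Requiring \<open>k \<le> r k\<close> instead of strict monotonicity suffices to reach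
  every tail and is easy to preserve under index shifts.\<close>

lemma omega_limitI:
  assumes "\<And>k. k \<le> r k" "(\<lambda>k. (f ^^ r k) x) \<longlonglongrightarrow> y"
  shows "y \<in> omega_limit x"
  unfolding omega_limit_def
proof
  fix N
  have "(f ^^ r (N + k)) x \<in> (\<lambda>k. (f ^^ k) x) ` {N..}" for k
    using assms(1)[of "N + k"] by (intro imageI) simp
  moreover have "(\<lambda>k. (f ^^ r (N + k)) x) \<longlonglongrightarrow> y"
    using LIMSEQ_ignore_initial_segment[OF assms(2), of N] by (simp add: add.commute)
  ultimately show "y \<in> closure ((\<lambda>k. (f ^^ k) x) ` {N..})"
    unfolding closure_sequential by (intro exI[of _ "\<lambda>k. (f ^^ r (N + k)) x"]) blast
qed

lemma omega_limitE:
  assumes "y \<in> omega_limit x"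
  obtains r where "\<And>k. k \<le> r k" "(\<lambda>k. (f ^^ r k) x) \<longlonglongrightarrow> y"
proof -
  have "\<exists>m\<ge>k. dist ((f ^^ m) x) y < inverse (real (Suc k))" for k
  proof -
    have "y \<in> closure ((\<lambda>k. (f ^^ k) x) ` {k..})" using assms by (simp add: omega_limit_def)
    then have "\<exists>z\<in>(\<lambda>k. (f ^^ k) x) ` {k..}. dist z y < inverse (real (Suc k))"
      unfolding closure_approachable by (elim allE impE) simp_all
    then show ?thesis by auto
  qed
  then obtain r where r: "\<And>k. k \<le> r k" "\<And>k. dist ((f ^^ r k) x) y < inverse (real (Suc k))"
    by metis
  have "\<forall>\<^sub>F k in sequentially. norm (dist ((f ^^ r k) x) y) \<le> inverse (real (Suc k))"
    using r(2) by (intro always_eventually allI less_imp_le) simp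
  then have "(\<lambda>k. dist ((f ^^ r k) x) y) \<longlonglongrightarrow> 0"
    using LIMSEQ_inverse_real_of_nat by (rule Lim_null_comparison)
  then have "(\<lambda>k. (f ^^ r k) x) \<longlonglongrightarrow> y" by (rule iffD2[OF tendsto_dist_iff])
  then show ?thesis using that r(1) by blast
qed

lemma bounded_orbit: "bounded (range (\<lambda>k. (f ^^ k) x))"
proof -
  have "dist v ((f ^^ k) x) \<le> (\<Sum>i\<in>(UNIV :: 'n set). norm (x - v))" for k
  proof -
    have "norm ((f ^^ k) x - v) \<le> (\<Sum>i\<in>UNIV. \<bar>((f ^^ k) x - v) $ i\<bar>)" by (rule norm_le_l1_cart)
    also have "\<dots> \<le> (\<Sum>i\<in>(UNIV :: 'n set). norm (x - v))"
      by (intro sum_mono) (simp add: funpow_bound)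
    finally show ?thesis by (simp add: dist_norm norm_minus_commute)
  qed
  then show ?thesis unfolding bounded_def by blast
qed

lemma compact_omega_limit: "compact (omega_limit x)"
  unfolding compact_eq_bounded_closed
proof
  have "omega_limit x \<subseteq> closure ((\<lambda>k. (f ^^ k) x) ` {0..})"
    unfolding omega_limit_def by (rule INT_lower) simp
  then have "omega_limit x \<subseteq> closure (range (\<lambda>k. (f ^^ k) x))" by (simp add: atLeast_0)
  then show "bounded (omega_limit x)"
    by (rule bounded_subset[OF bounded_closure[OF bounded_orbit]])
  show "closed (omega_limit x)" unfolding omega_limit_def by (intro closed_INT) auto
qed

lemma omega_limit_image:
  assumes "y \<in> omega_limit x"
  shows "f y \<in> omega_limit x"
proof -
  obtain r where r: "\<And>k. k \<le> r k" "(\<lambda>k. (f ^^ r k) x) \<longlonglongrightarrow> y"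
    using assms by (rule omega_limitE) blast
  show ?thesis
    by (rule omega_limitI[of "\<lambda>k. Suc (r k)"]) (use r(1) tendsto_map[OF r(2)] in \<open>auto intro: le_SucI\<close>)
qed

lemma omega_limit_funpow: "y \<in> omega_limit x \<Longrightarrow> (f ^^ k) y \<in> omega_limit x"
  by (induction k) (auto intro: omega_limit_image)

lemma omega_limit_preimage:
  assumes "y \<in> omega_limit x"
  obtains y' where "y' \<in> omega_limit x" "f y' = y"
proof -
  obtain r where r: "\<And>k. k \<le> r k" "(\<lambda>k. (f ^^ r k) x) \<longlonglongrightarrow> y"
    using assms by (rule omega_limitE) blast
  \<comment> \<open>\<open>r (Suc k)\<close> is at least 1, so each of these orbit points has a
    predecessor on the orbit; a cluster point of the predecessors is the preimage.\<close>
  define s where "s k = r (Suc k) - 1" for k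
  have s: "k \<le> s k" "Suc (s k) = r (Suc k)" for k using r(1)[of "Suc k"] by (auto simp: s_def)
  have "bounded (range (\<lambda>k. (f ^^ s k) x))" by (rule bounded_subset[OF bounded_orbit]) auto
  then obtain y' q where q: "strict_mono q" "((\<lambda>k. (f ^^ s k) x) \<circ> q) \<longlonglongrightarrow> y'"
    using bounded_imp_convergent_subsequence by blast
  have lim: "(\<lambda>k. (f ^^ s (q k)) x) \<longlonglongrightarrow> y'" using q(2) by (simp add: o_def)
  have "y' \<in> omega_limit x"
    using seq_suble[OF q(1)] s(1) by (intro omega_limitI[OF _ lim]) (rule order_trans)
  moreover have "(\<lambda>k. f ((f ^^ s (q k)) x)) = (\<lambda>k. (f ^^ r (Suc (q k))) x)"
    unfolding s(2)[symmetric] by simp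
  then have "(\<lambda>k. (f ^^ r (Suc (q k))) x) \<longlonglongrightarrow> f y'" using tendsto_map[OF lim] by simp
  moreover have "(\<lambda>k. (f ^^ r (Suc (q k))) x) \<longlonglongrightarrow> y"
    using LIMSEQ_subseq_LIMSEQ[OF LIMSEQ_Suc[OF r(2)] q(1)] by (simp add: o_def)
  ultimately show ?thesis using that LIMSEQ_unique by blast
qed

text \<open>
  Integrating against the stationary measure of \<open>P\<close> on \<open>F\<close> gives a quantity that increases along
  orbits, so it is constant on the limit set and the subgradient inequality is an equality there.
\<close>

lemma omega_limit_affine:
  assumes P: "crit_pair P F" and y: "y \<in> omega_limit x" and i: "i \<in> F"
  shows "f y $ i - v $ i = (\<Sum>j\<in>F. P $ i $ j * (y $ j - v $ j))"
proof -
  obtain m where m: "\<And>i. i \<in> F \<Longrightarrow> 0 < m i" "\<And>j. j \<in> F \<Longrightarrow> (\<Sum>i\<in>F. m i * P $ i $ j) = m j"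
    using P final_class_stationary_measure unfolding crit_pair_def by metis
  define \<phi> where "\<phi> z = (\<Sum>i\<in>F. m i * (z $ i - v $ i))" for z :: "real ^ 'n"
  have push: "(\<Sum>i\<in>F. m i * (\<Sum>j\<in>F. P $ i $ j * (z $ j - v $ j))) = \<phi> z" for z
  proof -
    have "(\<Sum>i\<in>F. m i * (\<Sum>j\<in>F. P $ i $ j * (z $ j - v $ j)))
        = (\<Sum>j\<in>F. (\<Sum>i\<in>F. m i * P $ i $ j) * (z $ j - v $ j))"
      unfolding sum_distrib_left sum_distrib_right mult.assoc by (rule sum.swap)
    then show ?thesis using m(2) by (simp add: \<phi>_def)
  qed
  have "\<phi> z \<le> \<phi> (f z)" for z
    unfolding push[symmetric, of z] unfolding \<phi>_def
    by (intro sum_mono mult_left_mono crit_pair_step[OF P] less_imp_le[OF m(1)])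
  then have "incseq (\<lambda>k. \<phi> ((f ^^ k) x))" by (intro incseq_SucI) simp
  moreover have "\<phi> ((f ^^ k) x) \<le> (\<Sum>i\<in>F. m i * norm (x - v))" for k
    unfolding \<phi>_def using funpow_bound[of k x]
    by (intro sum_mono mult_left_mono less_imp_le[OF m(1)]) (auto simp: abs_le_iff)
  ultimately obtain L where L: "(\<lambda>k. \<phi> ((f ^^ k) x)) \<longlonglongrightarrow> L"
    using incseq_convergent by metis
  have \<phi>L: "\<phi> z = L" if "z \<in> omega_limit x" for z
  proof -
    obtain r where r: "\<And>k. k \<le> r k" "(\<lambda>k. (f ^^ r k) x) \<longlonglongrightarrow> z"
      using \<open>z \<in> omega_limit x\<close> by (rule omega_limitE) blast
    have "filterlim r at_top sequentially"
      using r(1) by (intro filterlim_at_top_mono[OF filterlim_ident]) auto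
    then have "(\<lambda>k. \<phi> ((f ^^ r k) x)) \<longlonglongrightarrow> L" using filterlim_compose[OF L] by blast
    moreover have "(\<lambda>k. \<phi> ((f ^^ r k) x)) \<longlonglongrightarrow> \<phi> z"
      unfolding \<phi>_def by (intro tendsto_intros r(2))
    ultimately show ?thesis using LIMSEQ_unique by blast
  qed
  have "(\<Sum>i\<in>F. m i * (f y $ i - v $ i - (\<Sum>j\<in>F. P $ i $ j * (y $ j - v $ j)))) = \<phi> (f y) - \<phi> y"
    by (simp only: right_diff_distrib[of _ "_ - _"] sum_subtractf push) (simp add: \<phi>_def)
  also have "\<dots> = 0" using \<phi>L omega_limit_image y by simp
  finally have "\<forall>i\<in>F. m i * (f y $ i - v $ i - (\<Sum>j\<in>F. P $ i $ j * (y $ j - v $ j))) = 0"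
    using m(1) crit_pair_step[OF P, of _ y]
    by (subst (asm) sum_nonneg_eq_0_iff) (auto intro!: mult_nonneg_nonneg simp: less_imp_le)
  then show ?thesis using m(1)[OF i] i by force
qed

section \<open>Circuits of a critical class and periodicity on the limit set\<close>

lemma crit_class_path:
  assumes K: "K \<in> crit_classes f v" and "i \<in> K" "(i, j) \<in> (crit_arcs f v)\<^sup>*"
  shows "j \<in> K \<and> (i, j) \<in> (crit_arcs f v \<inter> K \<times> K)\<^sup>*"
  using assms(3)
proof (induction rule: rtrancl_induct)
  case (step y z)
  have "z \<in> crit_nodes f v" using step(2) crit_arcs_iff crit_nodes_iff by blast
  \<comment> \<open>Accessibility along critical arcs is symmetric, so a path never leaves its
    class.\<close>
  moreover have "(y, z) \<in> (crit_arcs f v)\<^sup>*" "(z, y) \<in> (crit_arcs f v)\<^sup>*"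
    using step(2) crit_arcs_sym by blast+
  ultimately have "z \<in> K"
    using classes_eq(1)[OF K[unfolded crit_classes_def], of y] step.IH by blast
  then show ?case using step by (meson IntI SigmaI rtrancl.rtrancl_into_rtrancl)
qed (use assms(2) in simp)

lemma class_connected:
  assumes K: "K \<in> crit_classes f v" and "i \<in> K" "j \<in> K"
  shows "\<exists>k. (i, j) \<in> (crit_arcs f v \<inter> K \<times> K) ^^ k"
proof -
  have "(i, j) \<in> (crit_arcs f v)\<^sup>*"
    using classes_eq(1)[OF K[unfolded crit_classes_def] assms(2)] assms(3) by blast
  then show ?thesis using crit_class_path[OF K assms(2)] by (simp add: rtrancl_power)
qed

text \<open>Two closed walks at a prescribed node whose lengths differ exactly by the cyclicity. The
  cyclicity is a gcd over circuits through any node of the class; joining such a circuit to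
  \<open>i\<close> by paths in both directions shows that the closed walks at \<open>i\<close> alone
  have the same gcd.\<close>

lemma class_circuit_lengths:
  assumes K: "K \<in> crit_classes f v" and i: "i \<in> K"
  obtains a where "0 < a" "(i, i) \<in> crit_arcs f v ^^ a"
    "(i, i) \<in> crit_arcs f v ^^ (a + class_cyclicity (crit_arcs f v) K)"
proof -
  let ?B = "crit_arcs f v \<inter> K \<times> K"
  define S where "S = {k. 0 < k \<and> (i, i) \<in> ?B ^^ k}"
  have add: "a + b \<in> S" if "a \<in> S" "b \<in> S" for a b
    using that by (auto simp: S_def relpow_add)
  have "i \<in> crit_nodes f v" using classes_subset[OF K[unfolded crit_classes_def]] i by blast
  then obtain P F where P: "crit_pair P F" "i \<in> F" using crit_nodes_iff by blast
  \<comment> \<open>Row sum 1 gives an arc out of \<open>i\<close>, so a circuit of positive length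
    exists even if the class is a single node.\<close>
  have "(\<Sum>j\<in>F. P $ i $ j) \<noteq> 0" using crit_pair_sum(2)[OF P] by simp
  then obtain j where j: "j \<in> F" "P $ i $ j \<noteq> 0" by (meson sum.neutral)
  then have "(i, j) \<in> crit_arcs f v" using P crit_arcs_iff by blast
  moreover have "j \<in> K" using crit_pair_class[OF P(1) K P(2) i] j(1) by blast
  ultimately have ij: "(i, j) \<in> ?B" using i by blast
  obtain b where "(j, i) \<in> ?B ^^ b" using class_connected[OF K \<open>j \<in> K\<close> i] by blast
  with ij have "(i, i) \<in> ?B ^^ Suc b" by (rule relpow_Suc_I2)
  then have "Suc b \<in> S" by (simp add: S_def)
  then have "S \<noteq> {}" by blast
  have dvd: "Gcd S dvd k" if k: "0 < k" and j: "j \<in> K" and jj: "(j, j) \<in> ?B ^^ k" for j k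
  proof -
    obtain a b where ab: "(i, j) \<in> ?B ^^ a" "(j, i) \<in> ?B ^^ b"
      using class_connected[OF K i j] class_connected[OF K j i] by blast
    have "(i, i) \<in> ?B ^^ (a + k + b)"
      unfolding relpow_add using ab jj by blast
    then have akb: "Gcd S dvd a + k + b" using k by (intro Gcd_dvd) (simp add: S_def)
    have "Gcd S dvd a + b"
    proof (cases "a + b = 0")
      case False
      have "(i, i) \<in> ?B ^^ (a + b)" unfolding relpow_add using ab by blast
      then show ?thesis using False by (intro Gcd_dvd) (simp add: S_def)
    qed simp
    then show ?thesis using akb by (metis add.assoc add.commute dvd_add_right_iff)
  qed
  have "class_cyclicity (crit_arcs f v) K = Gcd S"
  proof (rule dvd_antisym)
    show "class_cyclicity (crit_arcs f v) K dvd Gcd S"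
      unfolding class_cyclicity_def by (intro Gcd_greatest Gcd_dvd) (use i in \<open>auto simp: S_def\<close>)
    show "Gcd S dvd class_cyclicity (crit_arcs f v) K"
      unfolding class_cyclicity_def by (intro Gcd_greatest) (use dvd in auto)
  qed
  moreover obtain a where "a \<in> S" "a + Gcd S \<in> S"
    by (rule Gcd_add_closed_difference[of S]) (use add \<open>S \<noteq> {}\<close> in \<open>auto simp: S_def\<close>)
  moreover have "?B ^^ k \<subseteq> crit_arcs f v ^^ k" for k
  proof (induction k)
    case (Suc k)
    then show ?case unfolding relpow.simps by (rule relcomp_mono) blast
  qed simp
  ultimately show ?thesis using that[of a] by (auto simp: S_def)
qed

text \<open>
  If \<open>f\<^sup>c(y)\<^sub>i - y\<^sub>i\<close> attains a negative minimum \<open>D\<close>, the same value is attained at the end of every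
  critical path along the backward orbit; along closed paths of lengths \<open>na\<close>, \<open>na + c\<close>,
  \<open>na + 2c\<close>, \<dots>, \<open>na + nc\<close> the values telescope to \<open>nD\<close>, which contradicts boundedness.
  The sign \<open>\<sigma>\<close> covers minimum and maximum simultaneously.
\<close>

lemma omega_limit_crit_periodic_aux:
  assumes \<sigma>: "\<sigma> * \<sigma> = (1::real)" and y: "y \<in> omega_limit x" and i: "i \<in> crit_nodes f v"
  shows "0 \<le> \<sigma> * ((f ^^ cyclicity f v) y $ i - y $ i)"
proof (rule ccontr)
  let ?C = "crit_nodes f v" and ?A = "crit_arcs f v" and ?c = "cyclicity f v" and ?Om = "omega_limit x"
  define w where "w j z = \<sigma> * ((f ^^ ?c) z $ j - z $ j)" for j z
  assume "\<not> 0 \<le> \<sigma> * ((f ^^ ?c) y $ i - y $ i)"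
  then have neg: "w i y < 0" by (simp add: w_def)
  have cont: "continuous_on ?Om (w j)" for j
    unfolding w_def using continuous_on_subset[OF continuous_funpow]
    by (intro continuous_intros) auto
  have ne: "?Om \<noteq> {}" and ne': "?C \<noteq> {}" using y i by blast+
  obtain i0 y0 where i0: "i0 \<in> ?C" and y0: "y0 \<in> ?Om"
      and min: "\<And>j z. j \<in> ?C \<Longrightarrow> z \<in> ?Om \<Longrightarrow> w i0 y0 \<le> w j z"
    by (rule compact_attains_inf_finite[where h = w, OF compact_omega_limit[of x] ne finite ne' cont]) blast
  define D where "D = w i0 y0"
  have D: "D < 0" using min[OF i y] neg by (simp add: D_def)
  \<comment> \<open>On the limit set \<open>f\<close> acts on \<open>F\<close> as \<open>P\<close>,
    so \<open>w l (f z)\<close> is a \<open>P\<close>-average of values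
    \<open>w k z \<ge> D\<close>; equality with \<open>D\<close> forces it at every successor of
    \<open>l\<close>.\<close>
  have step: "w j z = D" if "(l, j) \<in> ?A" "z \<in> ?Om" "w l (f z) = D" for l j z
  proof -
    obtain P F where P: "crit_pair P F" "l \<in> F" "j \<in> F" "P $ l $ j \<noteq> 0"
      using \<open>(l, j) \<in> ?A\<close> crit_arcs_iff by blast
    have fin: "finite F" by simp
    have "w l (f z) = \<sigma> * ((f ((f ^^ ?c) z) $ l - v $ l) - (f z $ l - v $ l))"
      by (simp add: w_def funpow_swap1)
    also have "\<dots> = \<sigma> * (\<Sum>k\<in>F. P $ l $ k * ((f ^^ ?c) z $ k - z $ k))"
      unfolding omega_limit_affine[OF P(1) omega_limit_funpow[OF that(2)] P(2)] omega_limit_affine[OF P(1) that(2) P(2)]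
      by (simp add: algebra_simps flip: sum_subtractf)
    also have "\<dots> = (\<Sum>k\<in>F. P $ l $ k * w k z)" by (simp add: w_def sum_distrib_left mult.left_commute)
    finally have "(\<Sum>k\<in>F. P $ l $ k * (w k z - D)) = 0"
      using that(3) crit_pair_sum(2)[OF P(1,2)]
      by (simp add: right_diff_distrib sum_subtractf flip: sum_distrib_right)
    moreover have nonneg: "0 \<le> P $ l $ k * (w k z - D)" if "k \<in> F" for k
      using crit_pair_sum(3)[OF P(1,2)] min[OF _ \<open>z \<in> ?Om\<close>] crit_pair_subset[OF P(1)] that
      by (auto simp: D_def)
    ultimately have "\<forall>k\<in>F. P $ l $ k * (w k z - D) = 0"
      using sum_nonneg_eq_0_iff[OF fin, of "\<lambda>k. P $ l $ k * (w k z - D)"] by simp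
    then show ?thesis using P(3,4) by auto
  qed
  have "\<forall>z\<in>?Om. \<exists>z'. z' \<in> ?Om \<and> f z' = z"
  proof
    fix z assume "z \<in> ?Om"
    then show "\<exists>z'. z' \<in> ?Om \<and> f z' = z" by (rule omega_limit_preimage) blast
  qed
  then have "\<exists>s. \<forall>z\<in>?Om. s z \<in> ?Om \<and> f (s z) = z" by (rule bchoice)
  then obtain s where "\<forall>z\<in>?Om. s z \<in> ?Om \<and> f (s z) = z" ..
  then have s: "s z \<in> ?Om \<and> f (s z) = z" if "z \<in> ?Om" for z using that by (rule bspec)
  define Y where "Y k = (s ^^ k) y0" for k
  have Y_Suc: "Y (Suc k) = s (Y k)" for k by (simp add: Y_def)
  have Y: "Y k \<in> ?Om" for k
  proof (induction k)
    case (Suc k)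
    show ?case unfolding Y_Suc using s[OF Suc] by (rule conjunct1)
  qed (simp add: Y_def y0)
  have fY: "f (Y (Suc k)) = Y k" for k unfolding Y_Suc using s[OF Y[of k]] by (rule conjunct2)
  have fkY: "(f ^^ k) (Y (k + l)) = Y l" for k l
  proof (induction k)
    case (Suc k)
    have "(f ^^ Suc k) (Y (Suc k + l)) = (f ^^ k) (f (Y (Suc (k + l))))" by (simp add: funpow_swap1)
    then show ?case using Suc by (simp add: fY)
  qed simp
  have path: "w j (Y k) = D" if "(i0, j) \<in> ?A ^^ k" for k j
    using that
  proof (induction k arbitrary: j)
    case 0
    then show ?case by (simp add: D_def Y_def)
  next
    case (Suc k)
    then obtain l where "(i0, l) \<in> ?A ^^ k" "(l, j) \<in> ?A" by auto
    then show ?case using step[of l j "Y (Suc k)"] Suc.IH[of l] Y fY by simp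
  qed
  obtain K where K: "K \<in> crit_classes f v" "i0 \<in> K"
    using i0 unfolding crit_classes_def by (rule classes_cover)
  obtain a0 where a0: "(i0, i0) \<in> ?A ^^ a0" "(i0, i0) \<in> ?A ^^ (a0 + class_cyclicity ?A K)"
    using class_circuit_lengths[OF K] by metis
  have "class_cyclicity ?A K dvd ?c" unfolding cyclicity_def using K(1) by (intro dvd_Lcm imageI)
  then obtain q where q: "?c = q * class_cyclicity ?A K" by (metis dvd_def mult.commute)
  have mult: "(i0, i0) \<in> ?A ^^ (n * k)" if "(i0, i0) \<in> ?A ^^ k" for n k
    using that by (induction n) (auto simp: relpow_add)
  \<comment> \<open>Repeating both closed walks \<open>q\<close> times turns the difference of their
    lengths into the full cyclicity \<open>?c\<close>.\<close>
  define a where "a = q * a0"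
  have a: "(i0, i0) \<in> ?A ^^ a" "(i0, i0) \<in> ?A ^^ (a + ?c)"
    using mult[OF a0(1), of q] mult[OF a0(2), of q] by (simp_all add: a_def q distrib_left)
  have "bounded ?Om" using compact_omega_limit compact_imp_bounded by blast
  then obtain B where B: "\<And>z. z \<in> ?Om \<Longrightarrow> norm z \<le> B" unfolding bounded_iff by blast
  have "real n * \<bar>D\<bar> \<le> 2 * B" for n
  proof -
    define t where "t k = Y (n * a + k * ?c) $ i0" for k
    have diff: "t k - t (Suc k) = \<sigma> * D" if "k < n" for k
    proof -
      \<comment> \<open>The closed path consists of \<open>n - Suc k\<close> walks of length
        \<open>a\<close> and \<open>Suc k\<close> walks of length \<open>a + ?c\<close>.\<close>
      have "n = (n - Suc k) + Suc k" using \<open>k < n\<close> by simp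
      then have "n * a = (n - Suc k) * a + Suc k * a" by (metis distrib_right)
      then have "n * a + Suc k * ?c = (n - Suc k) * a + Suc k * (a + ?c)"
        by (simp only: distrib_left add.assoc)
      then have "(i0, i0) \<in> ?A ^^ (n * a + Suc k * ?c)"
        using mult[OF a(1), of "n - Suc k"] mult[OF a(2), of "Suc k"] by (auto simp: relpow_add simp del: mult_Suc)
      from path[OF this] have "w i0 (Y (n * a + Suc k * ?c)) = D" .
      moreover have "(f ^^ ?c) (Y (n * a + Suc k * ?c)) = Y (n * a + k * ?c)"
        using fkY[of ?c "n * a + k * ?c"] by (simp add: algebra_simps)
      ultimately have "\<sigma> * (t k - t (Suc k)) = D" by (simp add: w_def t_def)
      then have "\<sigma> * \<sigma> * (t k - t (Suc k)) = \<sigma> * D" by (simp add: mult.assoc)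
      then show ?thesis by (simp add: \<sigma>)
    qed
    have "t 0 - t n = (\<Sum>k<n. t k - t (Suc k))" by (rule sum_lessThan_telescope'[symmetric])
    also have "\<dots> = real n * (\<sigma> * D)" using diff by simp
    finally have "\<bar>real n * (\<sigma> * D)\<bar> = \<bar>t 0 - t n\<bar>" by simp
    moreover have "\<bar>\<sigma>\<bar> = 1"
      using \<sigma> by (metis abs_mult abs_one abs_ge_zero power2_eq_square power2_eq_1_iff abs_minus_cancel)
    ultimately have "real n * \<bar>D\<bar> = \<bar>t 0 - t n\<bar>" by (simp add: abs_mult)
    moreover have "\<bar>t k\<bar> \<le> B" for k
      unfolding t_def using component_le_norm_cart B[OF Y] order_trans by blast
    from this[of 0] this[of n] have "\<bar>t 0 - t n\<bar> \<le> 2 * B" by linarith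
    ultimately show ?thesis by simp
  qed
  moreover obtain n where "2 * B < real n * \<bar>D\<bar>"
    using D reals_Archimedean3[of "\<bar>D\<bar>"] by auto
  ultimately show False by (simp add: not_less[symmetric])
qed

lemma omega_limit_crit_periodic:
  assumes "y \<in> omega_limit x" "i \<in> crit_nodes f v"
  shows "(f ^^ cyclicity f v) y $ i = y $ i"
  using omega_limit_crit_periodic_aux[OF _ assms, of 1] omega_limit_crit_periodic_aux[OF _ assms, of "-1"]
  by simp

text \<open>The power commutes with \<open>f\<close>, and \<open>f\<close> maps the limit set onto
  itself. So the pairs \<open>(?g z, z)\<close> form a compact set in which every pair has a
  predecessor, and so do the reversed pairs; on critical nodes the two components agree.\<close>

lemma omega_limit_periodic:
  assumes "y \<in> omega_limit x"
  shows "(f ^^ cyclicity f v) y = y"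
proof -
  let ?Om = "omega_limit x" and ?g = "f ^^ cyclicity f v"
  have cont: "continuous_on ?Om ?g" using continuous_on_subset[OF continuous_funpow] by blast
  have fg: "f (?g z) = ?g (f z)" for z by (simp add: funpow_swap1)
  show ?thesis
  proof (rule order_antisym)
    show "?g y \<le> y"
    proof (rule backward_comparison[of "(\<lambda>z. (?g z, z)) ` ?Om"])
      show "compact ((\<lambda>z. (?g z, z)) ` ?Om)"
        by (intro compact_continuous_image continuous_intros cont compact_omega_limit)
      show "\<exists>a' b'. (a', b') \<in> (\<lambda>z. (?g z, z)) ` ?Om \<and> f a' = a \<and> f b' = b"
        if "(a, b) \<in> (\<lambda>z. (?g z, z)) ` ?Om" for a b
      proof -
        obtain z where z: "z \<in> ?Om" "f z = b" using omega_limit_preimage[of b x] \<open>(a, b) \<in> _\<close> by blast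
        then have "f (?g z) = a" using fg \<open>(a, b) \<in> _\<close> by auto
        then show ?thesis using z by blast
      qed
    qed (use assms omega_limit_crit_periodic in auto)
    show "y \<le> ?g y"
    proof (rule backward_comparison[of "(\<lambda>z. (z, ?g z)) ` ?Om"])
      show "compact ((\<lambda>z. (z, ?g z)) ` ?Om)"
        by (intro compact_continuous_image continuous_intros cont compact_omega_limit)
      show "\<exists>a' b'. (a', b') \<in> (\<lambda>z. (z, ?g z)) ` ?Om \<and> f a' = a \<and> f b' = b"
        if "(a, b) \<in> (\<lambda>z. (z, ?g z)) ` ?Om" for a b
      proof -
        obtain z where z: "z \<in> ?Om" "f z = a" using omega_limit_preimage[of a x] \<open>(a, b) \<in> _\<close> by blast
        then have "f (?g z) = b" using fg \<open>(a, b) \<in> _\<close> by auto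
        then show ?thesis using z by blast
      qed
    qed (use assms omega_limit_crit_periodic in auto)
  qed
qed

section \<open>Convergence of the orbits\<close>

lemma convergent_funpow_cyclicity: "convergent (\<lambda>k. (f ^^ (k * cyclicity f v)) x)"
proof (cases "cyclicity f v = 0")
  \<comment> \<open>For the value 0, formally possible for an \<open>Lcm\<close>, the sequence is
    constant.\<close>
  case True
  then show ?thesis by (simp add: convergent_const)
next
  case False
  let ?c = "cyclicity f v"
  have "bounded (range (\<lambda>k. (f ^^ (k * ?c)) x))" by (rule bounded_subset[OF bounded_orbit]) auto
  then obtain y r where r: "strict_mono r" "((\<lambda>k. (f ^^ (k * ?c)) x) \<circ> r) \<longlonglongrightarrow> y"
    using bounded_imp_convergent_subsequence by blast
  have lim: "(\<lambda>k. (f ^^ (r k * ?c)) x) \<longlonglongrightarrow> y" using r(2) by (simp add: o_def)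
  have "k \<le> r k * ?c" for k
    using seq_suble[OF r(1), of k] False by (metis One_nat_def Suc_leI mult.right_neutral mult_le_mono neq0_conv)
  then have "y \<in> omega_limit x" using lim by (rule omega_limitI)
  then have per1: "(f ^^ ?c) y = y" by (rule omega_limit_periodic)
  have per: "(f ^^ (k * ?c)) y = y" for k
    by (induction k) (auto simp: funpow_add per1)
  \<comment> \<open>Nonexpansive iterates never move away from a point that they fix, so this
    cluster point is the limit.\<close>
  have "(\<lambda>k. (f ^^ (k * ?c)) x $ i) \<longlonglongrightarrow> y $ i" for i
  proof (rule LIMSEQ_I)
    fix e :: real assume e: "0 < e"
    obtain k0 where "norm ((f ^^ (r k0 * ?c)) x - y) < e / 2"
      using LIMSEQ_D[OF lim, of "e / 2"] e by auto
    then have near: "\<bar>(f ^^ (r k0 * ?c)) x $ j - y $ j\<bar> \<le> e / 2" for j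
      using component_le_norm_cart[of "(f ^^ (r k0 * ?c)) x - y" j] by simp
    have "norm ((f ^^ (k * ?c)) x $ i - y $ i) < e" if "r k0 \<le> k" for k
    proof -
      have "k * ?c = (k - r k0) * ?c + r k0 * ?c" using that by (simp flip: distrib_right)
      then have "(f ^^ (k * ?c)) x = (f ^^ ((k - r k0) * ?c)) ((f ^^ (r k0 * ?c)) x)"
        by (simp add: funpow_add)
      then have "\<bar>(f ^^ (k * ?c)) x $ i - y $ i\<bar> \<le> e / 2"
        using nonexpansive_funpow[OF near, of "(k - r k0) * ?c" i] by (simp add: per)
      then show ?thesis using e by simp
    qed
    then show "\<exists>N. \<forall>k\<ge>N. norm ((f ^^ (k * ?c)) x $ i - y $ i) < e" by blast
  qed
  then have "(\<lambda>k. (f ^^ (k * ?c)) x) \<longlonglongrightarrow> y" by (intro vec_tendstoI)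
  then show ?thesis by (rule convergentI)
qed

end

theorem corollary1p3:
  fixes f :: "real ^ 'n::finite \<Rightarrow> real ^ 'n" and v :: "real ^ 'n"
  assumes "convex_map f" and "mono f" and "subhomogeneous f"
    and "f v = v"
  shows
    "mono_homog_iso UNIV (crit_nodes f v) (fixed_points f) (crit_fixed_points f v)
       (restr (crit_nodes f v))
     \<and> inf_subsemilattice (crit_fixed_points f v)
     \<and> convex (crit_fixed_points f v)
     \<and> aff_dim (crit_fixed_points f v) \<le> int (card (crit_classes f v))
     \<and> (piecewise_affine f \<longrightarrow>
          aff_dim (crit_fixed_points f v) = int (card (crit_classes f v)))
     \<and> (\<forall>x. convergent (\<lambda>k. (f ^^ (k * cyclicity f v)) x))
     \<and> (crit_classes f v = {} \<longrightarrow> (\<exists>!x. f x = x))"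
proof -
  interpret convex_monotone_fixpoint f v using assms by unfold_locales
  have "\<exists>!x. f x = x" if "crit_classes f v = {}"
  proof -
    \<comment> \<open>Without critical nodes, any two fixed points agree on them vacuously.\<close>
    have "i \<notin> crit_nodes f v" for i
      using that classes_cover unfolding crit_classes_def by (metis empty_iff)
    then show ?thesis using fixpoint fixed_points_eq by metis
  qed
  then show ?thesis
    using restr_mono_homog_iso inf_subsemilattice_crit_fixed_points convex_crit_fixed_points
      aff_dim_crit_fixed_points_le aff_dim_crit_fixed_points_ge convergent_funpow_cyclicity
    by (auto intro: order_antisym)
qed

end
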